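(* Let $F:\mathfrak{Sets}\rightleftarrows\mathfrak{C}:U$ be an adjunction ($F$ left adjoint to $U$) and let $I$ be a small category. Let $U_I:\mathfrak{C}^{I}\to\mathfrak{Sets}^{I_0}$ be the functor $U_I(A)(i)=U(A(i))$, with left adjoint $F_I$. If the adjunction $(F,U)$ is monadic, then the adjunction $(F_I,U_I)$ is monadic.
   Context: $I_0$ is the category with the same objects as $I$ and only identity morphisms. $F_I:\mathfrak{Sets}^{I_0}\to\mathfrak{C}^{I}$ is the composite of the left Kan extension $\mathfrak{Sets}^{I_0}\to\mathfrak{Sets}^{I}$, $Lan(X)(i)=\coprod_{x\to i}X(x)$ (coproduct over all morphisms of $I$ with target $i$), with the functor $\mathfrak{Sets}^{I}\to\mathfrak{C}^{I}$ given by applying $F$ objectwise; it is left adjoint to $U_I$. The associated comonads are $\mathbb{G}=FU$ on $\mathfrak{C}$ and $\mathbb{G}_I=F_IU_I$ on $\mathfrak{C}^I$. An adjunction with right adjoint $V:\mathfrak{D}\to\mathfrak{X}$ and left adjoint $L$ is called monadic if the comparison functor $K:\mathfrak{D}\to\mathfrak{Alg}(VL)$ to the category of algebras over the monad $VL$ on $\mathfrak{X}$ is an equivalence of categories. *)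

theory Defs
  imports "HOL-Library.FuncSet" "HOL-Library.Equipollence"
begin

section \<open>Categories, functors, natural transformations\<close>

record ('o, 'm) cat =
  Obj :: "'o set"
  Arr :: "'m set"
  Dom :: "'m \<Rightarrow> 'o"
  Cod :: "'m \<Rightarrow> 'o"
  Id :: "'o \<Rightarrow> 'm"
  Comp :: "'m \<Rightarrow> 'm \<Rightarrow> 'm"  (infixl "\<cdot>\<index>" 70)

text \<open>Composition is in applicative order: \<open>g \<cdot>\<^bsub>C\<^esub> f\<close> is ``first \<open>f\<close>, then \<open>g\<close>''.\<close>

locale category =
  fixes C :: "('o, 'm) cat" (structure)
  assumes Dom_in [simp]: "f \<in> Arr C \<Longrightarrow> Dom C f \<in> Obj C"
    and Cod_in [simp]: "f \<in> Arr C \<Longrightarrow> Cod C f \<in> Obj C"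
    and Id_in [simp]: "x \<in> Obj C \<Longrightarrow> Id C x \<in> Arr C"
    and Dom_Id [simp]: "x \<in> Obj C \<Longrightarrow> Dom C (Id C x) = x"
    and Cod_Id [simp]: "x \<in> Obj C \<Longrightarrow> Cod C (Id C x) = x"
    and Comp_in [simp]:
      "f \<in> Arr C \<Longrightarrow> g \<in> Arr C \<Longrightarrow> Cod C f = Dom C g \<Longrightarrow> g \<cdot> f \<in> Arr C"
    and Dom_Comp [simp]:
      "f \<in> Arr C \<Longrightarrow> g \<in> Arr C \<Longrightarrow> Cod C f = Dom C g \<Longrightarrow> Dom C (g \<cdot> f) = Dom C f"
    and Cod_Comp [simp]:
      "f \<in> Arr C \<Longrightarrow> g \<in> Arr C \<Longrightarrow> Cod C f = Dom C g \<Longrightarrow> Cod C (g \<cdot> f) = Cod C g"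
    and Comp_Id_left [simp]: "f \<in> Arr C \<Longrightarrow> Id C (Cod C f) \<cdot> f = f"
    and Comp_Id_right [simp]: "f \<in> Arr C \<Longrightarrow> f \<cdot> Id C (Dom C f) = f"
    and Comp_assoc:
      "f \<in> Arr C \<Longrightarrow> g \<in> Arr C \<Longrightarrow> h \<in> Arr C \<Longrightarrow> Cod C f = Dom C g \<Longrightarrow> Cod C g = Dom C h
        \<Longrightarrow> h \<cdot> (g \<cdot> f) = (h \<cdot> g) \<cdot> f"

definition Hom :: "('o, 'm) cat \<Rightarrow> 'o \<Rightarrow> 'o \<Rightarrow> 'm set" where
  "Hom C x y = {f \<in> Arr C. Dom C f = x \<and> Cod C f = y}"

record ('o1, 'm1, 'o2, 'm2) ftor =
  fobj :: "'o1 \<Rightarrow> 'o2"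
  farr :: "'m1 \<Rightarrow> 'm2"

locale is_functor = C: category C + D: category D
  for C :: "('o1, 'm1) cat" and D :: "('o2, 'm2) cat" +
  fixes F :: "('o1, 'm1, 'o2, 'm2) ftor"
  assumes fobj_in: "x \<in> Obj C \<Longrightarrow> fobj F x \<in> Obj D"
    and farr_Hom: "f \<in> Arr C \<Longrightarrow> farr F f \<in> Hom D (fobj F (Dom C f)) (fobj F (Cod C f))"
    and farr_Id: "x \<in> Obj C \<Longrightarrow> farr F (Id C x) = Id D (fobj F x)"
    and farr_Comp: "f \<in> Arr C \<Longrightarrow> g \<in> Arr C \<Longrightarrow> Cod C f = Dom C g
      \<Longrightarrow> farr F (g \<cdot>\<^bsub>C\<^esub> f) = farr F g \<cdot>\<^bsub>D\<^esub> farr F f"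

definition id_ftor :: "('o, 'm, 'o, 'm) ftor" where
  "id_ftor = \<lparr>fobj = (\<lambda>x. x), farr = (\<lambda>f. f)\<rparr>"

definition comp_ftor ::
  "('o2, 'm2, 'o3, 'm3) ftor \<Rightarrow> ('o1, 'm1, 'o2, 'm2) ftor \<Rightarrow> ('o1, 'm1, 'o3, 'm3) ftor" where
  "comp_ftor G F = \<lparr>fobj = (\<lambda>x. fobj G (fobj F x)), farr = (\<lambda>f. farr G (farr F f))\<rparr>"

locale nat_trans = F: is_functor C D F + G: is_functor C D G
  for C :: "('o1, 'm1) cat" and D :: "('o2, 'm2) cat" and F G +
  fixes \<tau> :: "'o1 \<Rightarrow> 'm2"
  assumes component_Hom: "x \<in> Obj C \<Longrightarrow> \<tau> x \<in> Hom D (fobj F x) (fobj G x)"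
    and naturality: "f \<in> Arr C
      \<Longrightarrow> \<tau> (Cod C f) \<cdot>\<^bsub>D\<^esub> farr F f = farr G f \<cdot>\<^bsub>D\<^esub> \<tau> (Dom C f)"

definition is_iso :: "('o, 'm) cat \<Rightarrow> 'm \<Rightarrow> bool" where
  "is_iso C f \<longleftrightarrow> f \<in> Arr C \<and>
    (\<exists>g \<in> Hom C (Cod C f) (Dom C f).
      g \<cdot>\<^bsub>C\<^esub> f = Id C (Dom C f) \<and> f \<cdot>\<^bsub>C\<^esub> g = Id C (Cod C f))"

definition naturally_isomorphic ::
  "('o1, 'm1) cat \<Rightarrow> ('o2, 'm2) cat \<Rightarrow> ('o1, 'm1, 'o2, 'm2) ftor \<Rightarrow> ('o1, 'm1, 'o2, 'm2) ftor \<Rightarrow> bool"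
  where
  "naturally_isomorphic C D F G \<longleftrightarrow>
    (\<exists>\<tau>. nat_trans C D F G \<tau> \<and> (\<forall>x \<in> Obj C. is_iso D (\<tau> x)))"

definition is_equivalence ::
  "('o1, 'm1) cat \<Rightarrow> ('o2, 'm2) cat \<Rightarrow> ('o1, 'm1, 'o2, 'm2) ftor \<Rightarrow> bool" where
  "is_equivalence C D F \<longleftrightarrow> is_functor C D F \<and>
    (\<exists>G. is_functor D C G \<and>
      naturally_isomorphic C C id_ftor (comp_ftor G F) \<and>
      naturally_isomorphic D D (comp_ftor F G) id_ftor)"

section \<open>Adjunctions, algebras over a monad, monadicity\<close>

locale adjunction = L: is_functor X D L + V: is_functor D X V +
    unit: nat_trans X X id_ftor "comp_ftor V L" \<eta> +
    counit: nat_trans D D "comp_ftor L V" id_ftor \<epsilon>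
  for X :: "('o1, 'm1) cat" and D :: "('o2, 'm2) cat" and L V \<eta> \<epsilon> +
  assumes triangle_left: "x \<in> Obj X
      \<Longrightarrow> \<epsilon> (fobj L x) \<cdot>\<^bsub>D\<^esub> farr L (\<eta> x) = Id D (fobj L x)"
    and triangle_right: "d \<in> Obj D
      \<Longrightarrow> farr V (\<epsilon> d) \<cdot>\<^bsub>X\<^esub> \<eta> (fobj V d) = Id X (fobj V d)"

text \<open>In the concrete categories below an arrow carries its source and target, so that equal
  underlying maps between different objects are different arrows.\<close>

record ('o, 'f) arrow =
  src :: 'o
  tgt :: 'o
  fun_of :: 'f

definition is_algebra ::
  "('o, 'm) cat \<Rightarrow> ('o, 'm, 'o, 'm) ftor \<Rightarrow> ('o \<Rightarrow> 'm) \<Rightarrow> ('o \<Rightarrow> 'm) \<Rightarrow> 'o \<times> 'm \<Rightarrow> bool" where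
  "is_algebra X T \<eta> \<mu> = (\<lambda>(x, h). x \<in> Obj X \<and> h \<in> Hom X (fobj T x) x \<and>
    h \<cdot>\<^bsub>X\<^esub> \<eta> x = Id X x \<and>
    h \<cdot>\<^bsub>X\<^esub> farr T h = h \<cdot>\<^bsub>X\<^esub> \<mu> x)"

definition Alg ::
  "('o, 'm) cat \<Rightarrow> ('o, 'm, 'o, 'm) ftor \<Rightarrow> ('o \<Rightarrow> 'm) \<Rightarrow> ('o \<Rightarrow> 'm)
    \<Rightarrow> ('o \<times> 'm, ('o \<times> 'm, 'm) arrow) cat" where
  "Alg X T \<eta> \<mu> =
    \<lparr>Obj = {a. is_algebra X T \<eta> \<mu> a},
     Arr = {f. is_algebra X T \<eta> \<mu> (src f) \<and> is_algebra X T \<eta> \<mu> (tgt f) \<and>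
               fun_of f \<in> Hom X (fst (src f)) (fst (tgt f)) \<and>
               fun_of f \<cdot>\<^bsub>X\<^esub> snd (src f) = snd (tgt f) \<cdot>\<^bsub>X\<^esub> farr T (fun_of f)},
     Dom = src,
     Cod = tgt,
     Id = (\<lambda>a. \<lparr>src = a, tgt = a, fun_of = Id X (fst a)\<rparr>),
     Comp = (\<lambda>g f. \<lparr>src = src f, tgt = tgt g, fun_of = fun_of g \<cdot>\<^bsub>X\<^esub> fun_of f\<rparr>)\<rparr>"

text \<open>The category of algebras over the monad \<open>V L\<close>, with unit \<open>\<eta>\<close> and
  multiplication \<open>V \<epsilon> L\<close>.\<close>

definition adj_Alg ::
  "('o1, 'm1) cat \<Rightarrow> ('o1, 'm1, 'o2, 'm2) ftor \<Rightarrow> ('o2, 'm2, 'o1, 'm1) ftor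
    \<Rightarrow> ('o1 \<Rightarrow> 'm1) \<Rightarrow> ('o2 \<Rightarrow> 'm2) \<Rightarrow> ('o1 \<times> 'm1, ('o1 \<times> 'm1, 'm1) arrow) cat" where
  "adj_Alg X L V \<eta> \<epsilon> = Alg X (comp_ftor V L) \<eta> (\<lambda>x. farr V (\<epsilon> (fobj L x)))"

definition comparison ::
  "('o2, 'm2) cat \<Rightarrow> ('o2, 'm2, 'o1, 'm1) ftor \<Rightarrow> ('o2 \<Rightarrow> 'm2)
    \<Rightarrow> ('o2, 'm2, 'o1 \<times> 'm1, ('o1 \<times> 'm1, 'm1) arrow) ftor" where
  "comparison D V \<epsilon> =
    \<lparr>fobj = (\<lambda>d. (fobj V d, farr V (\<epsilon> d))),
     farr = (\<lambda>f. \<lparr>src = (fobj V (Dom D f), farr V (\<epsilon> (Dom D f))),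
                  tgt = (fobj V (Cod D f), farr V (\<epsilon> (Cod D f))),
                  fun_of = farr V f\<rparr>)\<rparr>"

definition monadic ::
  "('o1, 'm1) cat \<Rightarrow> ('o2, 'm2) cat \<Rightarrow> ('o1, 'm1, 'o2, 'm2) ftor \<Rightarrow> ('o2, 'm2, 'o1, 'm1) ftor
    \<Rightarrow> ('o1 \<Rightarrow> 'm1) \<Rightarrow> ('o2 \<Rightarrow> 'm2) \<Rightarrow> bool" where
  "monadic X D L V \<eta> \<epsilon> \<longleftrightarrow>
    is_equivalence D (adj_Alg X L V \<eta> \<epsilon>) (comparison D V \<epsilon>)"

section \<open>The category of sets\<close>

text \<open>\<open>\<U>\<close> is the collection of small sets. Together with closure under power sets, the axioms
  describe the sets of cardinality below an uncountable strongly inaccessible cardinal, that is, a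
  Grothendieck universe up to equivalence of the resulting categories of sets. Power sets play no
  role below, and without them the axioms have models in HOL, for instance all sets of natural
  numbers.\<close>

locale set_universe =
  fixes \<U> :: "'u set set"
  assumes singleton_small: "{x} \<in> \<U>"
    and subset_small: "A \<in> \<U> \<Longrightarrow> B \<subseteq> A \<Longrightarrow> B \<in> \<U>"
    and Union_small: "A \<in> \<U> \<Longrightarrow> (\<And>a. a \<in> A \<Longrightarrow> X a \<in> \<U>) \<Longrightarrow> (\<Union>a\<in>A. X a) \<in> \<U>"
    and infinite_small: "\<exists>A \<in> \<U>. infinite A"

definition small_category :: "'u set set \<Rightarrow> ('o, 'm) cat \<Rightarrow> bool" where
  "small_category \<U> I \<longleftrightarrow>
    category I \<and> (\<exists>A \<in> \<U>. Obj I \<approx> A) \<and> (\<exists>A \<in> \<U>. Arr I \<approx> A)"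

type_synonym 'u setarr = "('u set, 'u \<Rightarrow> 'u) arrow"

definition Sets :: "'u set set \<Rightarrow> ('u set, 'u setarr) cat" where
  "Sets \<U> =
    \<lparr>Obj = \<U>,
     Arr = {f. src f \<in> \<U> \<and> tgt f \<in> \<U> \<and> fun_of f \<in> src f \<rightarrow>\<^sub>E tgt f},
     Dom = src,
     Cod = tgt,
     Id = (\<lambda>A. \<lparr>src = A, tgt = A, fun_of = (\<lambda>a\<in>A. a)\<rparr>),
     Comp = (\<lambda>g f. \<lparr>src = src f, tgt = tgt g, fun_of = compose (src f) (fun_of g) (fun_of f)\<rparr>)\<rparr>"

section \<open>Functor categories\<close>

type_synonym ('i, 'n, 'o, 'm) ntrans = "(('i, 'n, 'o, 'm) ftor, 'i \<Rightarrow> 'm) arrow"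

text \<open>Objects and components are made \<open>undefined\<close> outside \<open>I\<close>, so that equality in the functor
  category is equality of functors on \<open>I\<close>.\<close>

definition extensional_ftor :: "('i, 'n) cat \<Rightarrow> ('i, 'n, 'o, 'm) ftor \<Rightarrow> bool" where
  "extensional_ftor I A \<longleftrightarrow> fobj A \<in> extensional (Obj I) \<and> farr A \<in> extensional (Arr I)"

definition FunCat ::
  "('i, 'n) cat \<Rightarrow> ('o, 'm) cat \<Rightarrow> (('i, 'n, 'o, 'm) ftor, ('i, 'n, 'o, 'm) ntrans) cat" where
  "FunCat I C =
    \<lparr>Obj = {A. is_functor I C A \<and> extensional_ftor I A},
     Arr = {t. extensional_ftor I (src t) \<and> extensional_ftor I (tgt t) \<and>
               nat_trans I C (src t) (tgt t) (fun_of t) \<and> fun_of t \<in> extensional (Obj I)},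
     Dom = src,
     Cod = tgt,
     Id = (\<lambda>A. \<lparr>src = A, tgt = A, fun_of = (\<lambda>i\<in>Obj I. Id C (fobj A i))\<rparr>),
     Comp = (\<lambda>t s. \<lparr>src = src s, tgt = tgt t,
                    fun_of = (\<lambda>i\<in>Obj I. fun_of t i \<cdot>\<^bsub>C\<^esub> fun_of s i)\<rparr>)\<rparr>"

definition discrete :: "('i, 'n) cat \<Rightarrow> ('i, 'n) cat" where
  "discrete I = I\<lparr>Arr := Id I ` Obj I\<rparr>"

text \<open>Postcomposition with \<open>G\<close>, with the result regarded as a functor on the subcategory \<open>J\<close> of
  the source.\<close>

definition postcomp ::
  "('i, 'n) cat \<Rightarrow> ('o1, 'm1, 'o2, 'm2) ftor
    \<Rightarrow> (('i, 'n, 'o1, 'm1) ftor, ('i, 'n, 'o1, 'm1) ntrans,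
        ('i, 'n, 'o2, 'm2) ftor, ('i, 'n, 'o2, 'm2) ntrans) ftor" where
  "postcomp J G =
    (let G_of = (\<lambda>A. \<lparr>fobj = (\<lambda>i\<in>Obj J. fobj G (fobj A i)),
                      farr = (\<lambda>f\<in>Arr J. farr G (farr A f))\<rparr>)
     in \<lparr>fobj = G_of,
         farr = (\<lambda>t. \<lparr>src = G_of (src t), tgt = G_of (tgt t),
                      fun_of = (\<lambda>i\<in>Obj J. farr G (fun_of t i))\<rparr>)\<rparr>)"

type_synonym ('i, 'n, 'u) setftor = "('i, 'n, 'u set, 'u setarr) ftor"

type_synonym ('i, 'n, 'u) setnat = "('i, 'n, 'u set, 'u setarr) ntrans"

definition U_I ::
  "('i, 'n) cat \<Rightarrow> ('o, 'm, 'u set, 'u setarr) ftor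
    \<Rightarrow> (('i, 'n, 'o, 'm) ftor, ('i, 'n, 'o, 'm) ntrans, ('i, 'n, 'u) setftor, ('i, 'n, 'u) setnat) ftor"
  where
  "U_I I U = postcomp (discrete I) U"

section \<open>The left Kan extension\<close>

text \<open>A coproduct in \<open>Sets \<U>\<close> is a disjoint sum \<open>\<Sigma> j\<in>J. X j\<close>, transported into \<open>\<U>\<close> along a
  chosen injection.\<close>

definition code :: "'u set set \<Rightarrow> ('n \<times> 'u) set \<Rightarrow> 'n \<times> 'u \<Rightarrow> 'u" where
  "code \<U> S = (SOME c. inj_on c S \<and> c ` S \<in> \<U>)"

definition Coprod :: "'u set set \<Rightarrow> 'n set \<Rightarrow> ('n \<Rightarrow> 'u set) \<Rightarrow> 'u set" where
  "Coprod \<U> J X = code \<U> (Sigma J X) ` Sigma J X"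

definition inject :: "'u set set \<Rightarrow> 'n set \<Rightarrow> ('n \<Rightarrow> 'u set) \<Rightarrow> 'n \<Rightarrow> 'u \<Rightarrow> 'u" where
  "inject \<U> J X j a = code \<U> (Sigma J X) (j, a)"

definition copair ::
  "'u set set \<Rightarrow> 'n set \<Rightarrow> ('n \<Rightarrow> 'u set) \<Rightarrow> ('n \<Rightarrow> 'u \<Rightarrow> 'u) \<Rightarrow> 'u \<Rightarrow> 'u" where
  "copair \<U> J X g =
    (\<lambda>z\<in>Coprod \<U> J X. case the_inv_into (Sigma J X) (code \<U> (Sigma J X)) z of (j, a) \<Rightarrow> g j a)"

definition arrows_to :: "('i, 'n) cat \<Rightarrow> 'i \<Rightarrow> 'n set" where
  "arrows_to I i = {x \<in> Arr I. Cod I x = i}"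

text \<open>For \<open>X\<close> on \<open>discrete I\<close>, the functor \<open>Lan_obj \<U> I X\<close> is
  \<open>i \<mapsto> \<Coprod>\<^bsub>x \<rightarrow> i\<^esub> X (Dom x)\<close>; an arrow \<open>f\<close> of \<open>I\<close> takes the summand of \<open>x\<close>
  identically to the summand of \<open>f \<cdot> x\<close>.\<close>

definition Lan_set :: "'u set set \<Rightarrow> ('i, 'n) cat \<Rightarrow> ('i, 'n, 'u) setftor \<Rightarrow> 'i \<Rightarrow> 'u set" where
  "Lan_set \<U> I X i = Coprod \<U> (arrows_to I i) (\<lambda>x. fobj X (Dom I x))"

definition Lan_in ::
  "'u set set \<Rightarrow> ('i, 'n) cat \<Rightarrow> ('i, 'n, 'u) setftor \<Rightarrow> 'i \<Rightarrow> 'n \<Rightarrow> 'u \<Rightarrow> 'u" where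
  "Lan_in \<U> I X i = inject \<U> (arrows_to I i) (\<lambda>x. fobj X (Dom I x))"

definition Lan_copair ::
  "'u set set \<Rightarrow> ('i, 'n) cat \<Rightarrow> ('i, 'n, 'u) setftor \<Rightarrow> 'i \<Rightarrow> ('n \<Rightarrow> 'u \<Rightarrow> 'u) \<Rightarrow> 'u \<Rightarrow> 'u" where
  "Lan_copair \<U> I X i = copair \<U> (arrows_to I i) (\<lambda>x. fobj X (Dom I x))"

definition Lan_obj :: "'u set set \<Rightarrow> ('i, 'n) cat \<Rightarrow> ('i, 'n, 'u) setftor \<Rightarrow> ('i, 'n, 'u) setftor"
  where
  "Lan_obj \<U> I X =
    \<lparr>fobj = (\<lambda>i\<in>Obj I. Lan_set \<U> I X i),
     farr = (\<lambda>f\<in>Arr I.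
       \<lparr>src = Lan_set \<U> I X (Dom I f), tgt = Lan_set \<U> I X (Cod I f),
        fun_of = Lan_copair \<U> I X (Dom I f) (\<lambda>x a. Lan_in \<U> I X (Cod I f) (f \<cdot>\<^bsub>I\<^esub> x) a)\<rparr>)\<rparr>"

definition Lan ::
  "'u set set \<Rightarrow> ('i, 'n) cat
    \<Rightarrow> (('i, 'n, 'u) setftor, ('i, 'n, 'u) setnat, ('i, 'n, 'u) setftor, ('i, 'n, 'u) setnat) ftor"
  where
  "Lan \<U> I =
    \<lparr>fobj = Lan_obj \<U> I,
     farr = (\<lambda>t. \<lparr>src = Lan_obj \<U> I (src t), tgt = Lan_obj \<U> I (tgt t),
       fun_of = (\<lambda>i\<in>Obj I.
         \<lparr>src = Lan_set \<U> I (src t) i, tgt = Lan_set \<U> I (tgt t) i,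
          fun_of = Lan_copair \<U> I (src t) i
            (\<lambda>x a. Lan_in \<U> I (tgt t) i x (fun_of (fun_of t (Dom I x)) a))\<rparr>)\<rparr>)\<rparr>"

section \<open>The adjunction on diagrams\<close>

definition F_I ::
  "'u set set \<Rightarrow> ('i, 'n) cat \<Rightarrow> ('u set, 'u setarr, 'o, 'm) ftor
    \<Rightarrow> (('i, 'n, 'u) setftor, ('i, 'n, 'u) setnat,
        ('i, 'n, 'o, 'm) ftor, ('i, 'n, 'o, 'm) ntrans) ftor" where
  "F_I \<U> I F = comp_ftor (postcomp I F) (Lan \<U> I)"

text \<open>The unit at \<open>X\<close> is \<open>X i \<rightarrow> Lan X i \<rightarrow> U (F (Lan X i))\<close>, the inclusion of the summand of the
  identity of \<open>i\<close> followed by \<open>\<eta>\<close>. The counit at \<open>A\<close> is \<open>F (Lan (U\<^sub>I A) i) \<rightarrow> F (U (A i)) \<rightarrow> A i\<close>,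
  where the first arrow is \<open>F\<close> of the map given by \<open>U (A x)\<close> on the summand of \<open>x\<close>, and the
  second is \<open>\<epsilon>\<close>.\<close>

definition unit_I ::
  "'u set set \<Rightarrow> ('i, 'n) cat \<Rightarrow> ('u set, 'u setarr, 'o, 'm) ftor
    \<Rightarrow> ('o, 'm, 'u set, 'u setarr) ftor \<Rightarrow> ('u set \<Rightarrow> 'u setarr)
    \<Rightarrow> ('i, 'n, 'u) setftor \<Rightarrow> ('i, 'n, 'u) setnat" where
  "unit_I \<U> I F U \<eta> X =
    \<lparr>src = X, tgt = fobj (U_I I U) (fobj (F_I \<U> I F) X),
     fun_of = (\<lambda>i\<in>Obj I.
       \<eta> (Lan_set \<U> I X i) \<cdot>\<^bsub>Sets \<U>\<^esub>
       \<lparr>src = fobj X i, tgt = Lan_set \<U> I X i,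
        fun_of = (\<lambda>a\<in>fobj X i. Lan_in \<U> I X i (Id I i) a)\<rparr>)\<rparr>"

definition counit_I ::
  "'u set set \<Rightarrow> ('i, 'n) cat \<Rightarrow> ('o, 'm) cat \<Rightarrow> ('u set, 'u setarr, 'o, 'm) ftor
    \<Rightarrow> ('o, 'm, 'u set, 'u setarr) ftor \<Rightarrow> ('o \<Rightarrow> 'm)
    \<Rightarrow> ('i, 'n, 'o, 'm) ftor \<Rightarrow> ('i, 'n, 'o, 'm) ntrans" where
  "counit_I \<U> I C F U \<epsilon> A =
    \<lparr>src = fobj (F_I \<U> I F) (fobj (U_I I U) A), tgt = A,
     fun_of = (\<lambda>i\<in>Obj I.
       \<epsilon> (fobj A i) \<cdot>\<^bsub>C\<^esub>
       farr F \<lparr>src = Lan_set \<U> I (fobj (U_I I U) A) i, tgt = fobj U (fobj A i),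
               fun_of = Lan_copair \<U> I (fobj (U_I I U) A) i
                 (\<lambda>x a. fun_of (farr U (farr A x)) a)\<rparr>)\<rparr>"

end

theory Submission
  imports Defs
begin

text \<open>Write \<open>T = U F\<close> and \<open>Lan X i = \<Coprod>\<^bsub>x \<rightarrow> i\<^esub> X (Dom x)\<close>, so that the monad of the adjunction on
  diagrams is \<open>X \<mapsto> (i \<mapsto> T (Lan X i))\<close>. The reason for the theorem is that an algebra over this
  monad is the same thing as a diagram \<open>I \<rightarrow> Alg T\<close>, and that diagrams in \<open>Alg T\<close> are diagrams in
  \<open>C\<close> because \<open>C\<close> is equivalent to \<open>Alg T\<close>.

  In detail, let \<open>h i : T (Lan X i) \<rightarrow> X i\<close> be an algebra structure. Restricting \<open>h i\<close> along the
  summand of the identity of \<open>i\<close> gives \<open>alg i : T (X i) \<rightarrow> X i\<close>, and restricting it along \<open>\<eta>\<close>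
  gives \<open>act_X i : Lan X i \<rightarrow> X i\<close>, whose component at \<open>f\<close> is a transition map
  \<open>tr f : X (Dom f) \<rightarrow> X (Cod f)\<close>. The associative law of \<open>h\<close>, restricted in these two ways,
  becomes \<open>alg i \<circ> T (h i) = h i \<circ> U \<epsilon>\<close> (\<open>alg_T_h\<close>) and \<open>tr f \<circ> h (Dom f) = h (Cod f) \<circ> T (Lan X f)\<close>
  (\<open>tr_h\<close>). From these two identities and the unit law it follows that each \<open>alg i\<close> is a
  \<open>T\<close>-algebra, that \<open>tr\<close> is functorial and consists of homomorphisms, and that
  \<open>h i = alg i \<circ> T (act_X i)\<close>, so that \<open>h\<close> is recovered from the diagram \<open>P = (X, alg, tr)\<close> in
  \<open>Alg T\<close>. A quasi-inverse of the comparison functor of \<open>(F, U)\<close> carries \<open>P\<close> to a diagram in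
  \<open>C\<close> whose comparison algebra is isomorphic to \<open>(X, h)\<close>: the comparison functor on diagrams is
  essentially surjective (\<open>comparison_I_hits_algebra\<close>).

  It is fully faithful by the same two restrictions (\<open>comparison_I_fully_faithful\<close>): a
  homomorphism between comparison algebras of diagrams \<open>A\<close> and \<open>B\<close> restricts to homomorphisms
  of \<open>T\<close>-algebras \<open>U (A i) \<rightarrow> U (B i)\<close> and commutes with the transition maps, hence comes from a
  unique natural transformation \<open>A \<rightarrow> B\<close>.

  Both the adjunction and the comparison are computed with the universal property of
  \<open>Lan X i\<close> as a coproduct: maps out of it are compared on summands.\<close>

section \<open>Arrow calculus\<close>

context category
begin

lemma HomI: "f \<in> Arr C \<Longrightarrow> Dom C f = x \<Longrightarrow> Cod C f = y \<Longrightarrow> f \<in> Hom C x y"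
  by (simp add: Hom_def)

lemma Comp_right_assoc:
  "f \<in> Arr C \<Longrightarrow> g \<in> Arr C \<Longrightarrow> h \<in> Arr C \<Longrightarrow> Cod C f = Dom C g \<Longrightarrow> Cod C g = Dom C h
    \<Longrightarrow> (h \<cdot> g) \<cdot> f = h \<cdot> (g \<cdot> f)"
  by (simp add: Comp_assoc)

text \<open>Composites are kept associated to the right; this turns an equation between composites
  into one that rewrites the front of a longer chain.\<close>

lemma Comp_front:
  assumes "h \<cdot> g = k" "f \<in> Arr C" "g \<in> Arr C" "h \<in> Arr C" "Cod C f = Dom C g"
    "Cod C g = Dom C h"
  shows "h \<cdot> (g \<cdot> f) = k \<cdot> f"
  using assms by (simp add: Comp_assoc)

lemma Comp_Id_left': "f \<in> Arr C \<Longrightarrow> Cod C f = y \<Longrightarrow> Id C y \<cdot> f = f"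
  using Comp_Id_left by blast

lemma Comp_Id_right': "f \<in> Arr C \<Longrightarrow> Dom C f = x \<Longrightarrow> f \<cdot> Id C x = f"
  using Comp_Id_right by blast

lemma is_isoE:
  assumes "is_iso C f"
  obtains g where "f \<in> Arr C" "g \<in> Arr C" "Dom C g = Cod C f" "Cod C g = Dom C f"
    "g \<cdot> f = Id C (Dom C f)" "f \<cdot> g = Id C (Cod C f)"
  using assms by (auto simp: is_iso_def Hom_def)

lemma is_isoI:
  assumes "f \<in> Arr C" "g \<in> Arr C" "Dom C g = Cod C f" "Cod C g = Dom C f"
    "g \<cdot> f = Id C (Dom C f)" "f \<cdot> g = Id C (Cod C f)"
  shows "is_iso C f"
  using assms by (auto simp: is_iso_def Hom_def)

lemma iso_cancel_left:
  assumes "is_iso C h" "f \<in> Arr C" "g \<in> Arr C" "Cod C f = Dom C h" "Cod C g = Dom C h"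
    and eq: "h \<cdot> f = h \<cdot> g"
  shows "f = g"
proof -
  obtain k where k: "h \<in> Arr C" "k \<in> Arr C" "Dom C k = Cod C h" "k \<cdot> h = Id C (Dom C h)"
    using assms(1) by (rule is_isoE)
  have "f = k \<cdot> (h \<cdot> f)"
    using k assms(2-5) by (simp add: Comp_assoc Comp_Id_left')
  also have "\<dots> = g"
    unfolding eq using k assms(2-5) by (simp add: Comp_assoc Comp_Id_left')
  finally show ?thesis .
qed

lemma iso_cancel_right:
  assumes "is_iso C h" "f \<in> Arr C" "g \<in> Arr C" "Dom C f = Cod C h" "Dom C g = Cod C h"
    and eq: "f \<cdot> h = g \<cdot> h"
  shows "f = g"
proof -
  obtain k where k: "h \<in> Arr C" "k \<in> Arr C" "Dom C k = Cod C h" "Cod C k = Dom C h"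
    "h \<cdot> k = Id C (Cod C h)"
    using assms(1) by (rule is_isoE)
  have "f = (f \<cdot> h) \<cdot> k"
    using k assms(2-5) by (simp add: Comp_right_assoc Comp_Id_right')
  also have "\<dots> = g"
    unfolding eq using k assms(2-5) by (simp add: Comp_right_assoc Comp_Id_right')
  finally show ?thesis .
qed

end

context is_functor
begin

lemma farr_in [simp]: "f \<in> Arr C \<Longrightarrow> farr F f \<in> Arr D"
  and Dom_farr [simp]: "f \<in> Arr C \<Longrightarrow> Dom D (farr F f) = fobj F (Dom C f)"
  and Cod_farr [simp]: "f \<in> Arr C \<Longrightarrow> Cod D (farr F f) = fobj F (Cod C f)"
  using farr_Hom[of f] by (simp_all add: Hom_def)

lemmas [simp] = fobj_in farr_Id

end

lemma is_functorI:
  assumes "category C" "category D"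
    and "\<And>x. x \<in> Obj C \<Longrightarrow> fobj F x \<in> Obj D"
    and "\<And>f. f \<in> Arr C \<Longrightarrow> farr F f \<in> Arr D"
    and "\<And>f. f \<in> Arr C \<Longrightarrow> Dom D (farr F f) = fobj F (Dom C f)"
    and "\<And>f. f \<in> Arr C \<Longrightarrow> Cod D (farr F f) = fobj F (Cod C f)"
    and "\<And>x. x \<in> Obj C \<Longrightarrow> farr F (Id C x) = Id D (fobj F x)"
    and "\<And>f g. f \<in> Arr C \<Longrightarrow> g \<in> Arr C \<Longrightarrow> Cod C f = Dom C g
      \<Longrightarrow> farr F (g \<cdot>\<^bsub>C\<^esub> f) = farr F g \<cdot>\<^bsub>D\<^esub> farr F f"
  shows "is_functor C D F"
  using assms by (auto simp: is_functor_def is_functor_axioms_def Hom_def)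

lemma nat_transI:
  assumes "is_functor C D F" "is_functor C D G"
    and "\<And>x. x \<in> Obj C \<Longrightarrow> \<tau> x \<in> Arr D"
    and "\<And>x. x \<in> Obj C \<Longrightarrow> Dom D (\<tau> x) = fobj F x"
    and "\<And>x. x \<in> Obj C \<Longrightarrow> Cod D (\<tau> x) = fobj G x"
    and "\<And>f. f \<in> Arr C \<Longrightarrow> \<tau> (Cod C f) \<cdot>\<^bsub>D\<^esub> farr F f = farr G f \<cdot>\<^bsub>D\<^esub> \<tau> (Dom C f)"
  shows "nat_trans C D F G \<tau>"
  using assms by (auto simp: nat_trans_def nat_trans_axioms_def Hom_def)

context nat_trans
begin

lemma component_in [simp]: "x \<in> Obj C \<Longrightarrow> \<tau> x \<in> Arr D"
  and Dom_component [simp]: "x \<in> Obj C \<Longrightarrow> Dom D (\<tau> x) = fobj F x"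
  and Cod_component [simp]: "x \<in> Obj C \<Longrightarrow> Cod D (\<tau> x) = fobj G x"
  using component_Hom[of x] by (simp_all add: Hom_def)

end

lemma fobj_id_ftor [simp]: "fobj id_ftor x = x"
  and farr_id_ftor [simp]: "farr id_ftor f = f"
  and fobj_comp_ftor [simp]: "fobj (comp_ftor G F) x = fobj G (fobj F x)"
  and farr_comp_ftor [simp]: "farr (comp_ftor G F) f = farr G (farr F f)"
  by (simp_all add: id_ftor_def comp_ftor_def)

lemma (in category) id_ftor_functor: "is_functor C C id_ftor"
  by (rule is_functorI) (simp_all add: category_axioms)

lemma comp_ftor_functor:
  assumes "is_functor C D F" "is_functor D E G"
  shows "is_functor C E (comp_ftor G F)"
proof -
  interpret F: is_functor C D F by fact
  interpret G: is_functor D E G by fact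
  show ?thesis
    by (rule is_functorI) (simp_all add: F.farr_Comp G.farr_Comp F.C.category_axioms G.D.category_axioms)
qed

section \<open>Equivalences are the fully faithful, essentially surjective functors\<close>

definition fully_faithful ::
  "('o1, 'm1) cat \<Rightarrow> ('o2, 'm2) cat \<Rightarrow> ('o1, 'm1, 'o2, 'm2) ftor \<Rightarrow> bool" where
  "fully_faithful C D F \<longleftrightarrow> (\<forall>x \<in> Obj C. \<forall>y \<in> Obj C. \<forall>g \<in> Hom D (fobj F x) (fobj F y).
    \<exists>!f. f \<in> Hom C x y \<and> farr F f = g)"

definition essentially_surjective ::
  "('o1, 'm1) cat \<Rightarrow> ('o2, 'm2) cat \<Rightarrow> ('o1, 'm1, 'o2, 'm2) ftor \<Rightarrow> bool" where
  "essentially_surjective C D F \<longleftrightarrow>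
    (\<forall>d \<in> Obj D. \<exists>c \<in> Obj C. \<exists>p. is_iso D p \<and> Dom D p = fobj F c \<and> Cod D p = d)"

lemma fully_faithfulD:
  assumes "fully_faithful C D F" "is_functor C D F"
    and "f \<in> Arr C" "g \<in> Arr C" "Dom C f = Dom C g" "Cod C f = Cod C g" "farr F f = farr F g"
  shows "f = g"
proof -
  interpret is_functor C D F by fact
  have "farr F g \<in> Hom D (fobj F (Dom C g)) (fobj F (Cod C g))"
    by (rule farr_Hom) fact
  then have "\<exists>!f. f \<in> Hom C (Dom C g) (Cod C g) \<and> farr F f = farr F g"
    using assms(1,4) by (simp add: fully_faithful_def)
  moreover have "f \<in> Hom C (Dom C g) (Cod C g)" "g \<in> Hom C (Dom C g) (Cod C g)"
    using assms by (simp_all add: Hom_def)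
  ultimately show ?thesis
    using assms(7) by blast
qed

text \<open>If \<open>F f = F g\<close>, then \<open>G F f = G F g\<close>, and the isomorphism of \<open>G F\<close> with the identity
  takes this back to \<open>f = g\<close>. For an equivalence it applies to \<open>F\<close> and to its quasi-inverse.\<close>

lemma faithful_if_left_inverse:
  assumes "is_functor C D F" "is_functor D C G"
    and "nat_trans C C id_ftor (comp_ftor G F) \<tau>" "\<And>x. x \<in> Obj C \<Longrightarrow> is_iso C (\<tau> x)"
    and "f \<in> Arr C" "g \<in> Arr C" "Dom C f = Dom C g" "Cod C f = Cod C g" "farr F f = farr F g"
  shows "f = g"
proof -
  interpret F: is_functor C D F by fact
  interpret G: is_functor D C G by fact
  interpret T: nat_trans C C id_ftor "comp_ftor G F" \<tau> by fact
  have "\<tau> (Cod C f) \<cdot>\<^bsub>C\<^esub> f = \<tau> (Cod C f) \<cdot>\<^bsub>C\<^esub> g"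
    using T.naturality[OF assms(5)] T.naturality[OF assms(6)] assms(5-) by simp
  then show ?thesis
    using assms(4-) by - (rule F.C.iso_cancel_left[of "\<tau> (Cod C f)"], simp_all)
qed

lemma naturally_isomorphic_sym:
  assumes "naturally_isomorphic C D F G"
  shows "naturally_isomorphic C D G F"
proof -
  obtain \<tau> where "nat_trans C D F G \<tau>" and iso: "\<And>x. x \<in> Obj C \<Longrightarrow> is_iso D (\<tau> x)"
    using assms by (auto simp: naturally_isomorphic_def)
  then interpret nat_trans C D F G \<tau> by simp
  have "\<exists>k. k \<in> Arr D \<and> Dom D k = fobj G x \<and> Cod D k = fobj F x
      \<and> k \<cdot>\<^bsub>D\<^esub> \<tau> x = Id D (fobj F x) \<and> \<tau> x \<cdot>\<^bsub>D\<^esub> k = Id D (fobj G x)" if "x \<in> Obj C" for x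
    using F.D.is_isoE[OF iso[OF that]] that by (metis Dom_component Cod_component)
  then obtain \<sigma> where \<sigma>: "\<And>x. x \<in> Obj C \<Longrightarrow> \<sigma> x \<in> Arr D \<and> Dom D (\<sigma> x) = fobj G x
      \<and> Cod D (\<sigma> x) = fobj F x \<and> \<sigma> x \<cdot>\<^bsub>D\<^esub> \<tau> x = Id D (fobj F x)
      \<and> \<tau> x \<cdot>\<^bsub>D\<^esub> \<sigma> x = Id D (fobj G x)"
    by metis
  have "nat_trans C D G F \<sigma>"
  proof (rule nat_transI)
    fix f assume f: "f \<in> Arr C"
    have \<sigma>': "\<sigma> x \<cdot>\<^bsub>D\<^esub> \<tau> x = Id D (fobj F x)" "\<tau> x \<cdot>\<^bsub>D\<^esub> \<sigma> x = Id D (fobj G x)"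
      "\<sigma> x \<in> Arr D" "Dom D (\<sigma> x) = fobj G x" "Cod D (\<sigma> x) = fobj F x" if "x \<in> Obj C" for x
      using \<sigma>[OF that] by auto
    have "(\<sigma> (Cod C f) \<cdot>\<^bsub>D\<^esub> farr G f) \<cdot>\<^bsub>D\<^esub> \<tau> (Dom C f)
        = \<sigma> (Cod C f) \<cdot>\<^bsub>D\<^esub> (\<tau> (Cod C f) \<cdot>\<^bsub>D\<^esub> farr F f)"
      using f by (simp add: F.D.Comp_right_assoc naturality \<sigma>')
    also have "\<dots> = (farr F f \<cdot>\<^bsub>D\<^esub> \<sigma> (Dom C f)) \<cdot>\<^bsub>D\<^esub> \<tau> (Dom C f)"
      using f by (simp add: F.D.Comp_front[OF \<sigma>'(1)] F.D.Comp_right_assoc \<sigma>' F.D.Comp_Id_left'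
        F.D.Comp_Id_right')
    finally show "\<sigma> (Cod C f) \<cdot>\<^bsub>D\<^esub> farr G f = farr F f \<cdot>\<^bsub>D\<^esub> \<sigma> (Dom C f)"
      using f by - (rule F.D.iso_cancel_right[OF iso[of "Dom C f"]], simp_all add: \<sigma>')
  qed (use \<sigma> F.is_functor_axioms G.is_functor_axioms in auto)
  moreover have "is_iso D (\<sigma> x)" if "x \<in> Obj C" for x
    using \<sigma>[OF that] that by (intro F.D.is_isoI[of _ "\<tau> x"]) simp_all
  ultimately show ?thesis
    by (auto simp: naturally_isomorphic_def)
qed

text \<open>A preimage of \<open>g\<close> is the conjugate of \<open>G g\<close> by the isomorphism \<open>\<tau> : 1 \<rightarrow> G F\<close>. It is mapped
  to \<open>g\<close> because \<open>G\<close> is itself faithful.\<close>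

lemma equivalence_fully_faithful:
  assumes "is_equivalence C D F"
  shows "fully_faithful C D F"
  unfolding fully_faithful_def
proof (intro ballI)
  obtain G where "is_functor C D F" "is_functor D C G"
    and GF: "naturally_isomorphic C C id_ftor (comp_ftor G F)"
    and FG: "naturally_isomorphic D D id_ftor (comp_ftor F G)"
    using assms unfolding is_equivalence_def by (metis naturally_isomorphic_sym)
  then interpret F: is_functor C D F + G: is_functor D C G by auto
  obtain \<tau> where T: "nat_trans C C id_ftor (comp_ftor G F) \<tau>"
    and \<tau>: "\<And>x. x \<in> Obj C \<Longrightarrow> is_iso C (\<tau> x)"
    using GF by (auto simp: naturally_isomorphic_def)
  obtain \<sigma> where S: "nat_trans D D id_ftor (comp_ftor F G) \<sigma>"
    and \<sigma>: "\<And>x. x \<in> Obj D \<Longrightarrow> is_iso D (\<sigma> x)"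
    using FG by (auto simp: naturally_isomorphic_def)
  interpret T: nat_trans C C id_ftor "comp_ftor G F" \<tau> by fact
  fix x y g
  assume x: "x \<in> Obj C" and y: "y \<in> Obj C" and "g \<in> Hom D (fobj F x) (fobj F y)"
  then have g: "g \<in> Arr D" "Dom D g = fobj F x" "Cod D g = fobj F y"
    by (simp_all add: Hom_def)
  obtain k where k: "k \<in> Arr C" "Dom C k = fobj G (fobj F y)" "Cod C k = y"
    "\<tau> y \<cdot>\<^bsub>C\<^esub> k = Id C (fobj G (fobj F y))"
    using F.C.is_isoE[OF \<tau>[OF y]] y by (metis T.Dom_component T.Cod_component fobj_comp_ftor fobj_id_ftor)
  define f where "f = k \<cdot>\<^bsub>C\<^esub> (farr G g \<cdot>\<^bsub>C\<^esub> \<tau> x)"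
  have f: "f \<in> Arr C" "Dom C f = x" "Cod C f = y"
    using x y g k by (simp_all add: f_def)
  have "farr G (farr F f) \<cdot>\<^bsub>C\<^esub> \<tau> x = \<tau> y \<cdot>\<^bsub>C\<^esub> f"
    using T.naturality[OF f(1)] f by simp
  also have "\<dots> = farr G g \<cdot>\<^bsub>C\<^esub> \<tau> x"
    unfolding f_def using x y g k by (simp add: F.C.Comp_front[OF k(4)] F.C.Comp_Id_left')
  finally have "farr G (farr F f) = farr G g"
    using x f g by - (rule F.C.iso_cancel_right[OF \<tau>[OF x]], simp_all)
  then have "farr F f = g"
    using f g by - (rule faithful_if_left_inverse[OF G.is_functor_axioms F.is_functor_axioms S \<sigma>], simp_all)
  then show "\<exists>!f. f \<in> Hom C x y \<and> farr F f = g"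
    using f faithful_if_left_inverse[OF F.is_functor_axioms G.is_functor_axioms T \<tau>]
    by (intro ex1I[of _ f]) (auto simp: Hom_def)
qed

text \<open>The quasi-inverse picks for each \<open>d\<close> an object \<open>G d\<close> with an isomorphism
  \<open>\<sigma> d : F (G d) \<rightarrow> d\<close>. On arrows it is then forced: \<open>F (G g)\<close> has to be the conjugate of \<open>g\<close>
  by \<open>\<sigma>\<close>, so that \<open>\<sigma>\<close> is natural.\<close>

lemma equivalence_if_fully_faithful:
  assumes "is_functor C D F" and ff: "fully_faithful C D F" and "essentially_surjective C D F"
  shows "is_equivalence C D F"
proof -
  interpret F: is_functor C D F by fact
  note faithful = fully_faithfulD[OF ff F.is_functor_axioms]
  have "\<exists>c p q. c \<in> Obj C \<and> p \<in> Arr D \<and> q \<in> Arr D \<and> Dom D p = fobj F c \<and> Cod D p = d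
      \<and> Dom D q = d \<and> Cod D q = fobj F c
      \<and> q \<cdot>\<^bsub>D\<^esub> p = Id D (fobj F c) \<and> p \<cdot>\<^bsub>D\<^esub> q = Id D d" if "d \<in> Obj D" for d
  proof -
    obtain c p where "c \<in> Obj C" "is_iso D p" "Dom D p = fobj F c" "Cod D p = d"
      using assms(3) \<open>d \<in> Obj D\<close> by (auto simp: essentially_surjective_def)
    moreover then obtain q where "p \<in> Arr D" "q \<in> Arr D" "Dom D q = Cod D p" "Cod D q = Dom D p"
      "q \<cdot>\<^bsub>D\<^esub> p = Id D (Dom D p)" "p \<cdot>\<^bsub>D\<^esub> q = Id D (Cod D p)"
      using F.D.is_isoE by metis
    ultimately show ?thesis
      by (intro exI[of _ c] exI[of _ p] exI[of _ q]) simp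
  qed
  then obtain Go \<sigma> \<sigma>' where G: "\<And>d. d \<in> Obj D \<Longrightarrow> Go d \<in> Obj C \<and> \<sigma> d \<in> Arr D \<and> \<sigma>' d \<in> Arr D
      \<and> Dom D (\<sigma> d) = fobj F (Go d) \<and> Cod D (\<sigma> d) = d \<and> Dom D (\<sigma>' d) = d
      \<and> Cod D (\<sigma>' d) = fobj F (Go d)
      \<and> \<sigma>' d \<cdot>\<^bsub>D\<^esub> \<sigma> d = Id D (fobj F (Go d)) \<and> \<sigma> d \<cdot>\<^bsub>D\<^esub> \<sigma>' d = Id D d"
    by metis
  have Go [simp]: "Go d \<in> Obj C" and \<sigma> [simp]: "\<sigma> d \<in> Arr D" "Dom D (\<sigma> d) = fobj F (Go d)"
      "Cod D (\<sigma> d) = d" and \<sigma>' [simp]: "\<sigma>' d \<in> Arr D" "Dom D (\<sigma>' d) = d"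
      "Cod D (\<sigma>' d) = fobj F (Go d)"
    and inv [simp]: "\<sigma>' d \<cdot>\<^bsub>D\<^esub> \<sigma> d = Id D (fobj F (Go d))" "\<sigma> d \<cdot>\<^bsub>D\<^esub> \<sigma>' d = Id D d"
    if "d \<in> Obj D" for d
    using G[OF that] by auto
  have \<sigma>_iso: "is_iso D (\<sigma> d)" if "d \<in> Obj D" for d
    by (rule F.D.is_isoI[of _ "\<sigma>' d"]) (simp_all add: that)
  define Ga where "Ga g = (THE f. f \<in> Hom C (Go (Dom D g)) (Go (Cod D g)) \<and>
    farr F f = \<sigma>' (Cod D g) \<cdot>\<^bsub>D\<^esub> (g \<cdot>\<^bsub>D\<^esub> \<sigma> (Dom D g)))" for g
  define G where "G = \<lparr>fobj = Go, farr = Ga\<rparr>"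
  have G_simps: "fobj G = Go" "farr G = Ga"
    by (simp_all add: G_def)
  have "Ga g \<in> Hom C (Go (Dom D g)) (Go (Cod D g)) \<and>
      farr F (Ga g) = \<sigma>' (Cod D g) \<cdot>\<^bsub>D\<^esub> (g \<cdot>\<^bsub>D\<^esub> \<sigma> (Dom D g))" if "g \<in> Arr D" for g
  proof -
    have "\<sigma>' (Cod D g) \<cdot>\<^bsub>D\<^esub> (g \<cdot>\<^bsub>D\<^esub> \<sigma> (Dom D g))
        \<in> Hom D (fobj F (Go (Dom D g))) (fobj F (Go (Cod D g)))"
      using that by (intro F.D.HomI) simp_all
    then show ?thesis
      unfolding Ga_def using ff that unfolding fully_faithful_def 
      by - (rule theI', simp)
  qed
  then have Ga [simp]: "Ga g \<in> Arr C" "Dom C (Ga g) = Go (Dom D g)" "Cod C (Ga g) = Go (Cod D g)"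
    "farr F (Ga g) = \<sigma>' (Cod D g) \<cdot>\<^bsub>D\<^esub> (g \<cdot>\<^bsub>D\<^esub> \<sigma> (Dom D g))" if "g \<in> Arr D" for g
    using that by (auto simp: Hom_def)
  note assoc = F.D.Comp_right_assoc F.D.Comp_Id_left' F.D.Comp_Id_right' F.D.Comp_front[OF inv(1)]
    F.D.Comp_front[OF inv(2)]
  have G: "is_functor D C G"
  proof (rule is_functorI)
    fix d assume d: "d \<in> Obj D"
    show "farr G (Id D d) = Id C (fobj G d)"
      using d by - (rule faithful, simp_all add: G_simps assoc)
  next
    fix f g assume fg: "f \<in> Arr D" "g \<in> Arr D" "Cod D f = Dom D g"
    show "farr G (g \<cdot>\<^bsub>D\<^esub> f) = farr G g \<cdot>\<^bsub>C\<^esub> farr G f"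
      using fg by - (rule faithful, simp_all add: G_simps assoc F.farr_Comp)
  qed (simp_all add: G_simps F.C.category_axioms F.D.category_axioms)
  then interpret G: is_functor D C G .
  have FG: "is_functor D D (comp_ftor F G)" and GF: "is_functor C C (comp_ftor G F)"
    by (rule comp_ftor_functor[OF G F.is_functor_axioms] comp_ftor_functor[OF F.is_functor_axioms G])+
  have "nat_trans D D (comp_ftor F G) id_ftor \<sigma>"
    by (rule nat_transI)
      (simp_all add: FG F.D.id_ftor_functor G_simps assoc)
  then have "naturally_isomorphic D D (comp_ftor F G) id_ftor"
    using \<sigma>_iso by (auto simp: naturally_isomorphic_def)
  moreover have "naturally_isomorphic C C id_ftor (comp_ftor G F)"
  proof -
    have "\<exists>f. f \<in> Hom C x (Go (fobj F x)) \<and> farr F f = \<sigma>' (fobj F x)"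
      "\<exists>f. f \<in> Hom C (Go (fobj F x)) x \<and> farr F f = \<sigma> (fobj F x)" if "x \<in> Obj C" for x
      using ff that unfolding fully_faithful_def
      by (metis F.D.HomI F.fobj_in Go \<sigma> \<sigma>')+
    then obtain \<tau> \<tau>' where "\<And>x. x \<in> Obj C \<Longrightarrow> \<tau> x \<in> Hom C x (Go (fobj F x))
        \<and> farr F (\<tau> x) = \<sigma>' (fobj F x) \<and> \<tau>' x \<in> Hom C (Go (fobj F x)) x
        \<and> farr F (\<tau>' x) = \<sigma> (fobj F x)"
      by metis
    then have \<tau> [simp]: "\<tau> x \<in> Arr C" "Dom C (\<tau> x) = x" "Cod C (\<tau> x) = Go (fobj F x)"
      "farr F (\<tau> x) = \<sigma>' (fobj F x)"
      and \<tau>' [simp]: "\<tau>' x \<in> Arr C" "Dom C (\<tau>' x) = Go (fobj F x)" "Cod C (\<tau>' x) = x"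
      "farr F (\<tau>' x) = \<sigma> (fobj F x)"
      if "x \<in> Obj C" for x
      using that by (auto simp: Hom_def)
    have "nat_trans C C id_ftor (comp_ftor G F) \<tau>"
    proof (rule nat_transI)
      fix f assume f: "f \<in> Arr C"
      show "\<tau> (Cod C f) \<cdot>\<^bsub>C\<^esub> farr id_ftor f = farr (comp_ftor G F) f \<cdot>\<^bsub>C\<^esub> \<tau> (Dom C f)"
        using f by - (rule faithful, simp_all add: G_simps assoc F.farr_Comp)
    qed (simp_all add: GF F.C.id_ftor_functor G_simps)
    moreover have "is_iso C (\<tau> x)" if "x \<in> Obj C" for x
    proof (rule F.C.is_isoI[of _ "\<tau>' x"])
      show "\<tau>' x \<cdot>\<^bsub>C\<^esub> \<tau> x = Id C (Dom C (\<tau> x))"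
        using that by - (rule faithful, simp_all add: F.farr_Comp)
      show "\<tau> x \<cdot>\<^bsub>C\<^esub> \<tau>' x = Id C (Cod C (\<tau> x))"
        using that by - (rule faithful, simp_all add: F.farr_Comp)
    qed (simp_all add: that)
    ultimately show ?thesis
      by (auto simp: naturally_isomorphic_def)
  qed
  ultimately show ?thesis
    unfolding is_equivalence_def using G F.is_functor_axioms by auto
qed

section \<open>Algebras and the comparison functor\<close>

context adjunction
begin

lemma unit_in [simp]: "x \<in> Obj X \<Longrightarrow> \<eta> x \<in> Arr X"
  and Dom_unit [simp]: "x \<in> Obj X \<Longrightarrow> Dom X (\<eta> x) = x"
  and Cod_unit [simp]: "x \<in> Obj X \<Longrightarrow> Cod X (\<eta> x) = fobj V (fobj L x)"
  using unit.component_in[of x] unit.Dom_component[of x] unit.Cod_component[of x] by simp_all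

lemma counit_in [simp]: "d \<in> Obj D \<Longrightarrow> \<epsilon> d \<in> Arr D"
  and Dom_counit [simp]: "d \<in> Obj D \<Longrightarrow> Dom D (\<epsilon> d) = fobj L (fobj V d)"
  and Cod_counit [simp]: "d \<in> Obj D \<Longrightarrow> Cod D (\<epsilon> d) = d"
  using counit.component_in[of d] counit.Dom_component[of d] counit.Cod_component[of d] by simp_all

lemma unit_natural:
  "f \<in> Arr X \<Longrightarrow> farr V (farr L f) \<cdot>\<^bsub>X\<^esub> \<eta> (Dom X f) = \<eta> (Cod X f) \<cdot>\<^bsub>X\<^esub> f"
  using unit.naturality[of f] by simp

lemma counit_natural:
  "f \<in> Arr D \<Longrightarrow> \<epsilon> (Cod D f) \<cdot>\<^bsub>D\<^esub> farr L (farr V f) = f \<cdot>\<^bsub>D\<^esub> \<epsilon> (Dom D f)"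
  using counit.naturality[of f] by simp

end

lemma Alg_simps [simp]:
  "Dom (Alg X T \<eta> \<mu>) = src" "Cod (Alg X T \<eta> \<mu>) = tgt"
  "Id (Alg X T \<eta> \<mu>) a = \<lparr>src = a, tgt = a, fun_of = Id X (fst a)\<rparr>"
  "g \<cdot>\<^bsub>Alg X T \<eta> \<mu>\<^esub> f = \<lparr>src = src f, tgt = tgt g, fun_of = fun_of g \<cdot>\<^bsub>X\<^esub> fun_of f\<rparr>"
  by (simp_all add: Alg_def)

lemma Alg_ObjI:
  assumes "x \<in> Obj X" "h \<in> Arr X" "Dom X h = fobj T x" "Cod X h = x"
    and "h \<cdot>\<^bsub>X\<^esub> \<eta> x = Id X x" "h \<cdot>\<^bsub>X\<^esub> farr T h = h \<cdot>\<^bsub>X\<^esub> \<mu> x"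
  shows "(x, h) \<in> Obj (Alg X T \<eta> \<mu>)"
  using assms by (simp add: Alg_def is_algebra_def Hom_def)

lemma Alg_ObjD:
  assumes "a \<in> Obj (Alg X T \<eta> \<mu>)"
  shows "fst a \<in> Obj X" "snd a \<in> Arr X" "Dom X (snd a) = fobj T (fst a)" "Cod X (snd a) = fst a"
    and "snd a \<cdot>\<^bsub>X\<^esub> \<eta> (fst a) = Id X (fst a)"
    and "snd a \<cdot>\<^bsub>X\<^esub> farr T (snd a) = snd a \<cdot>\<^bsub>X\<^esub> \<mu> (fst a)"
  using assms by (cases a; simp add: Alg_def is_algebra_def Hom_def)+

lemma Alg_ArrI:
  assumes "src f \<in> Obj (Alg X T \<eta> \<mu>)" "tgt f \<in> Obj (Alg X T \<eta> \<mu>)" "fun_of f \<in> Arr X"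
    and "Dom X (fun_of f) = fst (src f)" "Cod X (fun_of f) = fst (tgt f)"
    and "fun_of f \<cdot>\<^bsub>X\<^esub> snd (src f) = snd (tgt f) \<cdot>\<^bsub>X\<^esub> farr T (fun_of f)"
  shows "f \<in> Arr (Alg X T \<eta> \<mu>)"
  using assms by (simp add: Alg_def Hom_def)

lemma Alg_ArrD:
  assumes "f \<in> Arr (Alg X T \<eta> \<mu>)"
  shows "src f \<in> Obj (Alg X T \<eta> \<mu>)" "tgt f \<in> Obj (Alg X T \<eta> \<mu>)" "fun_of f \<in> Arr X"
    and "Dom X (fun_of f) = fst (src f)" "Cod X (fun_of f) = fst (tgt f)"
    and "fun_of f \<cdot>\<^bsub>X\<^esub> snd (src f) = snd (tgt f) \<cdot>\<^bsub>X\<^esub> farr T (fun_of f)"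
  using assms by (simp_all add: Alg_def Hom_def)

lemma Alg_category:
  assumes "is_functor X X T"
  shows "category (Alg X T \<eta> \<mu>)"
proof -
  interpret T: is_functor X X T by fact
  show ?thesis
  proof (unfold_locales, goal_cases)
    case (3 a)
    then show ?case
      using Alg_ObjD[OF 3]
      by (intro Alg_ArrI) (simp_all add: T.C.Comp_Id_left' T.C.Comp_Id_right')
  next
    case (6 f g)
    note f = Alg_ArrD[OF 6(1)] and g = Alg_ArrD[OF 6(2)]
    note facts = f g Alg_ObjD[OF f(1)] Alg_ObjD[OF f(2)] Alg_ObjD[OF g(2)]
    have "(fun_of g \<cdot>\<^bsub>X\<^esub> fun_of f) \<cdot>\<^bsub>X\<^esub> snd (src f)
        = snd (tgt g) \<cdot>\<^bsub>X\<^esub> farr T (fun_of g \<cdot>\<^bsub>X\<^esub> fun_of f)"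
      using facts 6(3)
      by (simp add: T.C.Comp_right_assoc T.farr_Comp T.C.Comp_front[OF g(6)])
    then show ?case
      using facts 6(3) by (intro Alg_ArrI) simp_all
  next
    case (9 f)
    note f = Alg_ArrD[OF 9]
    show ?case
      using f by (simp add: T.C.Comp_Id_left')
  next
    case (10 f)
    note f = Alg_ArrD[OF 10]
    show ?case
      using f by (simp add: T.C.Comp_Id_right')
  next
    case (11 f g h)
    then show ?case
      by (simp add: T.C.Comp_assoc Alg_ArrD)
  qed (auto dest: Alg_ArrD)
qed

text \<open>The inverse of a homomorphism of algebras, taken in the base category, is again a
  homomorphism.\<close>

lemma Alg_is_iso:
  assumes "is_functor X X T" and f: "f \<in> Arr (Alg X T \<eta> \<mu>)" and "is_iso X (fun_of f)"
  shows "is_iso (Alg X T \<eta> \<mu>) f"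
proof -
  interpret T: is_functor X X T by fact
  interpret A: category "Alg X T \<eta> \<mu>" by (rule Alg_category) fact
  note f' = Alg_ArrD[OF f]
  note facts = f' Alg_ObjD[OF f'(1)] Alg_ObjD[OF f'(2)]
  obtain g where g: "g \<in> Arr X" "Dom X g = Cod X (fun_of f)" "Cod X g = Dom X (fun_of f)"
    "g \<cdot>\<^bsub>X\<^esub> fun_of f = Id X (fst (src f))" "fun_of f \<cdot>\<^bsub>X\<^esub> g = Id X (fst (tgt f))"
    using T.C.is_isoE[OF assms(3)] f' by metis
  have "g \<cdot>\<^bsub>X\<^esub> snd (tgt f) = (g \<cdot>\<^bsub>X\<^esub> snd (tgt f)) \<cdot>\<^bsub>X\<^esub> farr T (fun_of f \<cdot>\<^bsub>X\<^esub> g)"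
    using facts g by (simp add: T.C.Comp_Id_right')
  also have "\<dots> = g \<cdot>\<^bsub>X\<^esub> ((snd (tgt f) \<cdot>\<^bsub>X\<^esub> farr T (fun_of f)) \<cdot>\<^bsub>X\<^esub> farr T g)"
    using facts(1-5,7-) g(1-3) by (simp add: T.C.Comp_right_assoc T.farr_Comp)
  also have "\<dots> = (g \<cdot>\<^bsub>X\<^esub> fun_of f) \<cdot>\<^bsub>X\<^esub> (snd (src f) \<cdot>\<^bsub>X\<^esub> farr T g)"
    unfolding f'(6)[symmetric]
    using facts(1-5,7-) g(1-3) by (simp add: T.C.Comp_right_assoc)
  also have "\<dots> = snd (src f) \<cdot>\<^bsub>X\<^esub> farr T g"
    unfolding g(4) using facts(1-5,7-) g(1-3) by (simp add: T.C.Comp_Id_left')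
  finally have "\<lparr>src = tgt f, tgt = src f, fun_of = g\<rparr> \<in> Arr (Alg X T \<eta> \<mu>)"
    using facts g by (intro Alg_ArrI) simp_all
  then show ?thesis
    using f g by (intro A.is_isoI[of _ "\<lparr>src = tgt f, tgt = src f, fun_of = g\<rparr>"]) simp_all
qed

lemma comparison_simps [simp]:
  "fobj (comparison D V \<epsilon>) d = (fobj V d, farr V (\<epsilon> d))"
  "src (farr (comparison D V \<epsilon>) f) = (fobj V (Dom D f), farr V (\<epsilon> (Dom D f)))"
  "tgt (farr (comparison D V \<epsilon>) f) = (fobj V (Cod D f), farr V (\<epsilon> (Cod D f)))"
  "fun_of (farr (comparison D V \<epsilon>) f) = farr V f"
  by (simp_all add: comparison_def)

lemma arrow_eqI:
  fixes f g :: "('o, 'f) arrow"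
  shows "src f = src g \<Longrightarrow> tgt f = tgt g \<Longrightarrow> fun_of f = fun_of g \<Longrightarrow> f = g"
  by (cases f; cases g) simp

context adjunction
begin

lemma monad_functor: "is_functor X X (comp_ftor V L)"
  by (rule comp_ftor_functor[OF L.is_functor_axioms V.is_functor_axioms])

lemma adj_Alg_category: "category (adj_Alg X L V \<eta> \<epsilon>)"
  unfolding adj_Alg_def by (rule Alg_category[OF monad_functor])

text \<open>The algebra laws at \<open>d\<close> are the triangle identity and naturality of \<open>\<epsilon>\<close> at \<open>\<epsilon> d\<close>; arrows go to
  homomorphisms by naturality of \<open>\<epsilon>\<close>.\<close>

lemma comparison_functor: "is_functor D (adj_Alg X L V \<eta> \<epsilon>) (comparison D V \<epsilon>)"
proof -
  have obj: "fobj (comparison D V \<epsilon>) d \<in> Obj (adj_Alg X L V \<eta> \<epsilon>)" if "d \<in> Obj D" for d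
    unfolding adj_Alg_def comparison_simps using that counit_natural[of "\<epsilon> d"]
    by (intro Alg_ObjI) (simp_all add: triangle_right flip: V.farr_Comp)
  have "farr (comparison D V \<epsilon>) f \<in> Arr (adj_Alg X L V \<eta> \<epsilon>)" if "f \<in> Arr D" for f
    unfolding adj_Alg_def using that obj[of "Dom D f"] obj[of "Cod D f"]
    by (intro Alg_ArrI) (simp_all add: adj_Alg_def counit_natural flip: V.farr_Comp)
  with obj adj_Alg_category show ?thesis
    by (intro is_functorI)
      (auto intro!: arrow_eqI L.D.category_axioms simp: adj_Alg_def V.farr_Comp)
qed

text \<open>The adjunct \<open>\<epsilon> \<circ> L q\<close> of \<open>q\<close> restricts along the unit to \<open>q\<close>.\<close>

lemma adjunct_unit:
  assumes "d \<in> Obj D" "q \<in> Arr X" "Dom X q = x" "Cod X q = fobj V d"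
  shows "farr V (\<epsilon> d) \<cdot>\<^bsub>X\<^esub> (farr V (farr L q) \<cdot>\<^bsub>X\<^esub> \<eta> x) = q"
proof -
  have "farr V (farr L q) \<cdot>\<^bsub>X\<^esub> \<eta> x = \<eta> (fobj V d) \<cdot>\<^bsub>X\<^esub> q"
    using assms unit_natural[of q] by simp
  then show ?thesis
    using assms L.C.Comp_front[OF triangle_right, of d q] by (simp add: L.C.Comp_Id_left')
qed

text \<open>The comparison functor remembers source and target in its arrows and acts on the underlying
  arrow as \<open>V\<close>, so its faithfulness is faithfulness of \<open>V\<close>, and its fullness lifts the
  homomorphisms of algebras along \<open>V\<close>.\<close>

lemma monadic_faithful:
  assumes "monadic X D L V \<eta> \<epsilon>"
    and "f \<in> Arr D" "g \<in> Arr D" "Dom D f = Dom D g" "Cod D f = Cod D g" "farr V f = farr V g"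
  shows "f = g"
proof -
  have "fully_faithful D (adj_Alg X L V \<eta> \<epsilon>) (comparison D V \<epsilon>)"
    using assms(1) unfolding monadic_def by (rule equivalence_fully_faithful)
  then show ?thesis
    using assms(2-) by - (erule fully_faithfulD[OF _ comparison_functor], auto intro: arrow_eqI)
qed

lemma monadic_full:
  assumes "monadic X D L V \<eta> \<epsilon>"
    and d: "d \<in> Obj D" and e: "e \<in> Obj D"
    and g: "g \<in> Arr X" "Dom X g = fobj V d" "Cod X g = fobj V e"
    and hom: "g \<cdot>\<^bsub>X\<^esub> farr V (\<epsilon> d) = farr V (\<epsilon> e) \<cdot>\<^bsub>X\<^esub> farr V (farr L g)"
  shows "\<exists>f. f \<in> Arr D \<and> Dom D f = d \<and> Cod D f = e \<and> farr V f = g"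
proof -
  interpret K: is_functor D "adj_Alg X L V \<eta> \<epsilon>" "comparison D V \<epsilon>"
    by (rule comparison_functor)
  let ?k = "\<lparr>src = fobj (comparison D V \<epsilon>) d, tgt = fobj (comparison D V \<epsilon>) e, fun_of = g\<rparr>"
  have "?k \<in> Arr (adj_Alg X L V \<eta> \<epsilon>)"
    using K.fobj_in[OF d] K.fobj_in[OF e] g hom unfolding adj_Alg_def
    by (intro Alg_ArrI) simp_all
  then have "?k \<in> Hom (adj_Alg X L V \<eta> \<epsilon>) (fobj (comparison D V \<epsilon>) d) (fobj (comparison D V \<epsilon>) e)"
    by (simp add: Hom_def adj_Alg_def)
  moreover have "fully_faithful D (adj_Alg X L V \<eta> \<epsilon>) (comparison D V \<epsilon>)"
    using assms(1) unfolding monadic_def by (rule equivalence_fully_faithful)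
  ultimately obtain f where "f \<in> Hom D d e" "farr (comparison D V \<epsilon>) f = ?k"
    using d e unfolding fully_faithful_def by blast
  moreover then have "farr V f = g"
    using comparison_simps(4)[of D V \<epsilon> f] by simp
  ultimately show ?thesis
    by (auto simp: Hom_def)
qed

end

section \<open>Functor categories\<close>

lemma FunCat_simps [simp]:
  "Dom (FunCat I C) = src" "Cod (FunCat I C) = tgt"
  "Id (FunCat I C) A = \<lparr>src = A, tgt = A, fun_of = (\<lambda>i\<in>Obj I. Id C (fobj A i))\<rparr>"
  "t \<cdot>\<^bsub>FunCat I C\<^esub> s = \<lparr>src = src s, tgt = tgt t,
    fun_of = (\<lambda>i\<in>Obj I. fun_of t i \<cdot>\<^bsub>C\<^esub> fun_of s i)\<rparr>"
  by (simp_all add: FunCat_def)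

lemma FunCat_ObjI:
  "is_functor I C A \<Longrightarrow> fobj A \<in> extensional (Obj I) \<Longrightarrow> farr A \<in> extensional (Arr I)
    \<Longrightarrow> A \<in> Obj (FunCat I C)"
  by (simp add: FunCat_def extensional_ftor_def)

lemma FunCat_ObjD:
  assumes "A \<in> Obj (FunCat I C)"
  shows "is_functor I C A" "fobj A \<in> extensional (Obj I)" "farr A \<in> extensional (Arr I)"
  using assms by (simp_all add: FunCat_def extensional_ftor_def)

lemma FunCat_Obj_at:
  assumes "A \<in> Obj (FunCat I C)"
  shows "i \<in> Obj I \<Longrightarrow> fobj A i \<in> Obj C"
    and "f \<in> Arr I \<Longrightarrow> farr A f \<in> Arr C"
    and "f \<in> Arr I \<Longrightarrow> Dom C (farr A f) = fobj A (Dom I f)"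
    and "f \<in> Arr I \<Longrightarrow> Cod C (farr A f) = fobj A (Cod I f)"
    and "i \<in> Obj I \<Longrightarrow> farr A (Id I i) = Id C (fobj A i)"
proof -
  interpret is_functor I C A
    using FunCat_ObjD(1)[OF assms] .
  show "i \<in> Obj I \<Longrightarrow> fobj A i \<in> Obj C" "f \<in> Arr I \<Longrightarrow> farr A f \<in> Arr C"
    "f \<in> Arr I \<Longrightarrow> Dom C (farr A f) = fobj A (Dom I f)"
    "f \<in> Arr I \<Longrightarrow> Cod C (farr A f) = fobj A (Cod I f)"
    "i \<in> Obj I \<Longrightarrow> farr A (Id I i) = Id C (fobj A i)"
    by simp_all
qed

lemma FunCat_Obj_Comp:
  assumes "A \<in> Obj (FunCat I C)" "f \<in> Arr I" "g \<in> Arr I" "Cod I f = Dom I g"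
  shows "farr A (g \<cdot>\<^bsub>I\<^esub> f) = farr A g \<cdot>\<^bsub>C\<^esub> farr A f"
  by (rule is_functor.farr_Comp[OF FunCat_ObjD(1)[OF assms(1)] assms(2-4)])

lemma FunCat_ArrI:
  assumes "src t \<in> Obj (FunCat I C)" "tgt t \<in> Obj (FunCat I C)" "fun_of t \<in> extensional (Obj I)"
    and "\<And>i. i \<in> Obj I \<Longrightarrow> fun_of t i \<in> Arr C"
    and "\<And>i. i \<in> Obj I \<Longrightarrow> Dom C (fun_of t i) = fobj (src t) i"
    and "\<And>i. i \<in> Obj I \<Longrightarrow> Cod C (fun_of t i) = fobj (tgt t) i"
    and "\<And>f. f \<in> Arr I \<Longrightarrow> fun_of t (Cod I f) \<cdot>\<^bsub>C\<^esub> farr (src t) f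
      = farr (tgt t) f \<cdot>\<^bsub>C\<^esub> fun_of t (Dom I f)"
  shows "t \<in> Arr (FunCat I C)"
  using assms nat_transI[of I C "src t" "tgt t" "fun_of t"]
  by (simp add: FunCat_def extensional_ftor_def)

lemma FunCat_ArrD:
  assumes "t \<in> Arr (FunCat I C)"
  shows "src t \<in> Obj (FunCat I C)" "tgt t \<in> Obj (FunCat I C)" "fun_of t \<in> extensional (Obj I)"
    and "i \<in> Obj I \<Longrightarrow> fun_of t i \<in> Arr C"
    and "i \<in> Obj I \<Longrightarrow> Dom C (fun_of t i) = fobj (src t) i"
    and "i \<in> Obj I \<Longrightarrow> Cod C (fun_of t i) = fobj (tgt t) i"
    and "f \<in> Arr I \<Longrightarrow> fun_of t (Cod I f) \<cdot>\<^bsub>C\<^esub> farr (src t) f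
      = farr (tgt t) f \<cdot>\<^bsub>C\<^esub> fun_of t (Dom I f)"
proof -
  have t: "nat_trans I C (src t) (tgt t) (fun_of t)" "extensional_ftor I (src t)"
    "extensional_ftor I (tgt t)"
    using assms by (simp_all add: FunCat_def)
  then interpret nat_trans I C "src t" "tgt t" "fun_of t" by simp
  show "src t \<in> Obj (FunCat I C)" "tgt t \<in> Obj (FunCat I C)" "fun_of t \<in> extensional (Obj I)"
    using assms t F.is_functor_axioms G.is_functor_axioms by (simp_all add: FunCat_def)
  show "i \<in> Obj I \<Longrightarrow> fun_of t i \<in> Arr C" "i \<in> Obj I \<Longrightarrow> Dom C (fun_of t i) = fobj (src t) i"
    "i \<in> Obj I \<Longrightarrow> Cod C (fun_of t i) = fobj (tgt t) i"
    "f \<in> Arr I \<Longrightarrow> fun_of t (Cod I f) \<cdot>\<^bsub>C\<^esub> farr (src t) f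
      = farr (tgt t) f \<cdot>\<^bsub>C\<^esub> fun_of t (Dom I f)"
    by (simp_all add: naturality)
qed

lemma FunCat_Arr_eqI:
  assumes "s \<in> Arr (FunCat I C)" "t \<in> Arr (FunCat I C)" "src s = src t" "tgt s = tgt t"
    and "\<And>i. i \<in> Obj I \<Longrightarrow> fun_of s i = fun_of t i"
  shows "s = t"
  using assms by (intro arrow_eqI extensionalityI[of _ "Obj I"]) (auto dest: FunCat_ArrD)

lemma FunCat_category:
  assumes "category I" "category C"
  shows "category (FunCat I C)"
proof -
  interpret I: category I by fact
  interpret C: category C by fact
  show ?thesis
  proof (unfold_locales, goal_cases)
    case (3 A)
    then show ?case
      by (intro FunCat_ArrI) (simp_all add: FunCat_Obj_at C.Comp_Id_left' C.Comp_Id_right')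
  next
    case (6 s t)
    note s = FunCat_ArrD[OF 6(1)] and t = FunCat_ArrD[OF 6(2)]
    show ?case
    proof (rule FunCat_ArrI)
      fix f assume f: "f \<in> Arr I"
      show "fun_of (t \<cdot>\<^bsub>FunCat I C\<^esub> s) (Cod I f) \<cdot>\<^bsub>C\<^esub> farr (src (t \<cdot>\<^bsub>FunCat I C\<^esub> s)) f
          = farr (tgt (t \<cdot>\<^bsub>FunCat I C\<^esub> s)) f \<cdot>\<^bsub>C\<^esub> fun_of (t \<cdot>\<^bsub>FunCat I C\<^esub> s) (Dom I f)"
        using f s(1-6) t(3-6) 6(3)
        by (simp add: C.Comp_right_assoc FunCat_Obj_at[OF s(1)] FunCat_Obj_at[OF s(2)]
            FunCat_Obj_at[OF t(1)] FunCat_Obj_at[OF t(2)] s(7) C.Comp_front[OF t(7)])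
    qed (use s t 6 in simp_all)
  next
    case (11 r s t)
    then show ?case
      by (auto intro!: restrict_ext simp: C.Comp_assoc FunCat_ArrD)
  qed (auto intro!: arrow_eqI extensionalityI[of _ "Obj I"] dest: FunCat_ArrD
      simp: FunCat_ArrD C.Comp_Id_left' C.Comp_Id_right')
qed

lemma discrete_simps [simp]:
  "Obj (discrete I) = Obj I" "Arr (discrete I) = Id I ` Obj I" "Dom (discrete I) = Dom I"
  "Cod (discrete I) = Cod I" "Id (discrete I) = Id I" "Comp (discrete I) = Comp I"
  by (simp_all add: discrete_def)

lemma discrete_category:
  assumes "category I"
  shows "category (discrete I)"
proof -
  interpret category I by fact
  show ?thesis
    by unfold_locales (auto simp: Comp_Id_left')
qed

text \<open>The only arrows of \<open>discrete I\<close> are identities, at which naturality is the unit laws.\<close>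

lemma FunCat_discrete_ArrI:
  assumes "category I" "category C"
    and "src t \<in> Obj (FunCat (discrete I) C)" "tgt t \<in> Obj (FunCat (discrete I) C)"
    and "fun_of t \<in> extensional (Obj I)"
    and "\<And>i. i \<in> Obj I \<Longrightarrow> fun_of t i \<in> Arr C"
    and "\<And>i. i \<in> Obj I \<Longrightarrow> Dom C (fun_of t i) = fobj (src t) i"
    and "\<And>i. i \<in> Obj I \<Longrightarrow> Cod C (fun_of t i) = fobj (tgt t) i"
  shows "t \<in> Arr (FunCat (discrete I) C)"
proof -
  interpret I: category I by fact
  interpret C: category C by fact
  note s = FunCat_Obj_at[OF assms(3), simplified] and t = FunCat_Obj_at[OF assms(4), simplified]
  show ?thesis
    by (rule FunCat_ArrI) (use assms s t in \<open>auto simp: C.Comp_Id_left' C.Comp_Id_right'\<close>)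
qed

lemma postcomp_simps [simp]:
  "i \<in> Obj J \<Longrightarrow> fobj (fobj (postcomp J G) A) i = fobj G (fobj A i)"
  "f \<in> Arr J \<Longrightarrow> farr (fobj (postcomp J G) A) f = farr G (farr A f)"
  "src (farr (postcomp J G) t) = fobj (postcomp J G) (src t)"
  "tgt (farr (postcomp J G) t) = fobj (postcomp J G) (tgt t)"
  "i \<in> Obj J \<Longrightarrow> fun_of (farr (postcomp J G) t) i = farr G (fun_of t i)"
  "fobj (fobj (postcomp J G) A) \<in> extensional (Obj J)"
  "farr (fobj (postcomp J G) A) \<in> extensional (Arr J)"
  "fun_of (farr (postcomp J G) t) \<in> extensional (Obj J)"
  by (simp_all add: postcomp_def)

text \<open>The case \<open>J = I\<close> gives the second factor of \<open>F_I\<close>, the case \<open>J = discrete I\<close> gives \<open>U_I\<close>.\<close>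

lemma postcomp_functor:
  assumes "category I" "category J" "is_functor C D G"
    and J: "Obj J = Obj I" "Arr J \<subseteq> Arr I" "Dom J = Dom I" "Cod J = Cod I" "Id J = Id I"
      "Comp J = Comp I"
  shows "is_functor (FunCat I C) (FunCat J D) (postcomp J G)"
proof -
  interpret I: category I by fact
  interpret J: category J by fact
  interpret G: is_functor C D G by fact
  interpret FC: category "FunCat I C"
    by (rule FunCat_category) (fact I.category_axioms G.C.category_axioms)+
  interpret FD: category "FunCat J D"
    by (rule FunCat_category) (fact J.category_axioms G.D.category_axioms)+
  have sub: "f \<in> Arr I" if "f \<in> Arr J" for f
    using that J by blast
  have obj: "fobj (postcomp J G) A \<in> Obj (FunCat J D)" if A: "A \<in> Obj (FunCat I C)" for A
  proof (rule FunCat_ObjI)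
    note at = FunCat_Obj_at[OF A]
    show "is_functor J D (fobj (postcomp J G) A)"
    proof (rule is_functorI)
      fix f g assume fg: "f \<in> Arr J" "g \<in> Arr J" "Cod J f = Dom J g"
      then have "g \<cdot>\<^bsub>I\<^esub> f \<in> Arr J"
        using J.Comp_in[of f g] J by simp
      then show "farr (fobj (postcomp J G) A) (g \<cdot>\<^bsub>J\<^esub> f)
          = farr (fobj (postcomp J G) A) g \<cdot>\<^bsub>D\<^esub> farr (fobj (postcomp J G) A) f"
        using fg sub J by (simp add: FunCat_Obj_Comp[OF A] G.farr_Comp at)
    next
      fix i assume "i \<in> Obj J"
      then show "farr (fobj (postcomp J G) A) (Id J i) = Id D (fobj (fobj (postcomp J G) A) i)"
        using J.Id_in[of i] J by (simp add: at)
    qed (use sub J at J.category_axioms G.D.category_axioms in auto)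
  qed simp_all
  show ?thesis
  proof (rule is_functorI)
    fix t assume t: "t \<in> Arr (FunCat I C)"
    note t' = FunCat_ArrD[OF t]
    note at = FunCat_Obj_at[OF t'(1)] FunCat_Obj_at[OF t'(2)]
    have ext: "fun_of (farr (postcomp J G) t) \<in> extensional (Obj J)"
      by simp
    show "farr (postcomp J G) t \<in> Arr (FunCat J D)"
    proof (rule FunCat_ArrI)
      fix f assume "f \<in> Arr J"
      then show "fun_of (farr (postcomp J G) t) (Cod J f) \<cdot>\<^bsub>D\<^esub> farr (src (farr (postcomp J G) t)) f
          = farr (tgt (farr (postcomp J G) t)) f \<cdot>\<^bsub>D\<^esub> fun_of (farr (postcomp J G) t) (Dom J f)"
        using sub[of f] t' J at by (simp flip: G.farr_Comp)
    qed (use t' J obj ext in auto)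
  next
    fix A assume "A \<in> Obj (FunCat I C)"
    then show "farr (postcomp J G) (Id (FunCat I C) A) = Id (FunCat J D) (fobj (postcomp J G) A)"
      using J by (auto intro!: arrow_eqI extensionalityI[of _ "Obj J"] simp: FunCat_Obj_at)
  next
    fix s t assume s: "s \<in> Arr (FunCat I C)" and t: "t \<in> Arr (FunCat I C)"
      and "Cod (FunCat I C) s = Dom (FunCat I C) t"
    then show "farr (postcomp J G) (t \<cdot>\<^bsub>FunCat I C\<^esub> s)
        = farr (postcomp J G) t \<cdot>\<^bsub>FunCat J D\<^esub> farr (postcomp J G) s"
      using J FunCat_ArrD[OF s] FunCat_ArrD[OF t]
      by (auto intro!: arrow_eqI extensionalityI[of _ "Obj J"] simp: G.farr_Comp)
  qed (auto intro: obj FC.category_axioms FD.category_axioms)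
qed

section \<open>Sets and their coproducts\<close>

text \<open>These are no default simplification rules, so that composites and identities in
  \<open>Sets \<U>\<close> stay folded and are handled by the laws of a category.\<close>

lemma Sets_simps:
  "Obj (Sets \<U>) = \<U>" "Dom (Sets \<U>) = src" "Cod (Sets \<U>) = tgt"
  "Id (Sets \<U>) A = \<lparr>src = A, tgt = A, fun_of = (\<lambda>a\<in>A. a)\<rparr>"
  "g \<cdot>\<^bsub>Sets \<U>\<^esub> f = \<lparr>src = src f, tgt = tgt g, fun_of = compose (src f) (fun_of g) (fun_of f)\<rparr>"
  by (simp_all add: Sets_def)

lemma Sets_Arr_iff: "f \<in> Arr (Sets \<U>) \<longleftrightarrow>
    src f \<in> \<U> \<and> tgt f \<in> \<U> \<and> fun_of f \<in> src f \<rightarrow>\<^sub>E tgt f"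
  by (simp add: Sets_def)

lemma Sets_category: "category (Sets \<U>)"
proof (unfold_locales, goal_cases)
  case (6 f g)
  then show ?case
    by (auto simp: Sets_simps Sets_Arr_iff compose_def)
next
  case (9 f)
  then show ?case
    by (auto intro!: arrow_eqI extensionalityI[of _ "src f"] simp: Sets_simps Sets_Arr_iff compose_def PiE_def)
next
  case (10 f)
  then show ?case
    by (auto intro!: arrow_eqI extensionalityI[of _ "src f"] simp: Sets_simps Sets_Arr_iff compose_def PiE_def)
next
  case (11 f g h)
  then show ?case
    by (auto intro!: arrow_eqI restrict_ext simp: Sets_simps Sets_Arr_iff compose_def)
qed (auto simp: Sets_simps Sets_Arr_iff)

context set_universe
begin

text \<open>A binary union is a union over a two-element set, which is small as a subset of an infinite
  small set.\<close>

lemma Un_small: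
  assumes "A \<in> \<U>" "B \<in> \<U>"
  shows "A \<union> B \<in> \<U>"
proof -
  obtain D where D: "D \<in> \<U>" "infinite D"
    using infinite_small by blast
  then obtain a b where ab: "a \<in> D" "b \<in> D" "a \<noteq> b"
    by (metis finite.emptyI finite_insert infinite_imp_nonempty insertI1 subset_singletonD
        subsetI equals0I finite_subset singletonD)
  then have "{a, b} \<in> \<U>"
    by (intro subset_small[OF D(1)]) auto
  then have "(\<Union>d\<in>{a, b}. if d = a then A else B) \<in> \<U>"
    by (rule Union_small) (use assms in auto)
  moreover have "(\<Union>d\<in>{a, b}. if d = a then A else B) = A \<union> B"
    using ab by auto
  ultimately show ?thesis
    by simp
qed

text \<open>The index set, all summands and an infinite set fit into one infinite small set \<open>D\<close>, and
  \<open>D \<times> D\<close> has the cardinality of \<open>D\<close>.\<close>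

lemma Sigma_codable:
  fixes J :: "'n set" and X :: "'n \<Rightarrow> 'u set"
  assumes "A \<in> \<U>" "J \<approx> A" and X: "\<And>j. j \<in> J \<Longrightarrow> X j \<in> \<U>"
  shows "\<exists>c. inj_on c (Sigma J X) \<and> c ` Sigma J X \<in> \<U>"
proof -
  obtain h where h: "bij_betw h J A"
    using assms(2) by (auto simp: eqpoll_def)
  obtain E where E: "E \<in> \<U>" "infinite E"
    using infinite_small by blast
  have "(\<Union>a\<in>A. X (inv_into J h a)) \<in> \<U>"
    using h by (intro Union_small assms X) (auto simp: bij_betw_def inv_into_into)
  moreover have "(\<Union>a\<in>A. X (inv_into J h a)) = (\<Union>j\<in>J. X j)"
    using h by (auto simp: bij_betw_def)
  ultimately have XJ: "(\<Union>j\<in>J. X j) \<in> \<U>"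
    by simp
  define D where "D = A \<union> ((\<Union>j\<in>J. X j) \<union> E)"
  have D: "D \<in> \<U>" "infinite D"
    using E XJ assms(1) by (auto simp: D_def intro!: Un_small)
  obtain p where p: "bij_betw p (D \<times> D) D"
    using card_of_Times_same_infinite[OF D(2)] card_of_ordIso by blast
  define c where "c = (\<lambda>(j, a). p (h j, a))"
  have hD: "h j \<in> D" if "j \<in> J" for j
    using h that by (auto simp: D_def bij_betw_def)
  have XD: "a \<in> D" if "j \<in> J" "a \<in> X j" for j a
    using that by (auto simp: D_def)
  have "inj_on c (Sigma J X)"
  proof (rule inj_onI)
    fix z w assume z: "z \<in> Sigma J X" and w: "w \<in> Sigma J X" and eq: "c z = c w"
    obtain j a k b where [simp]: "z = (j, a)" "w = (k, b)"
      by (cases z, cases w)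
    have "(h j, a) = (h k, b)"
      using eq z w hD XD p by (auto simp: c_def bij_betw_def dest: inj_onD)
    then show "z = w"
      using h z w by (auto simp: bij_betw_def dest: inj_onD)
  qed
  moreover have "c ` Sigma J X \<subseteq> D"
    using hD XD p by (fastforce simp: c_def bij_betw_def)
  ultimately show ?thesis
    using subset_small[OF D(1)] by blast
qed

end

locale small_diagrams = set_universe \<U> + I: category I
  for \<U> :: "'u set set" and I :: "('i, 'n) cat" +
  assumes small: "small_category \<U> I"
begin

abbreviation "S \<equiv> Sets \<U>"

abbreviation "Families \<equiv> FunCat (discrete I) S"

sublocale S: category S
  by (rule Sets_category)

sublocale Families: category Families
  by (rule FunCat_category[OF discrete_category[OF I.category_axioms] S.category_axioms])

lemma Families_at [simp]:
  assumes "X \<in> Obj Families" "i \<in> Obj I"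
  shows "fobj X i \<in> Obj S"
  using FunCat_Obj_at(1)[OF assms(1)] assms(2) by simp

lemma arrows_to_iff [simp]: "x \<in> arrows_to I i \<longleftrightarrow> x \<in> Arr I \<and> Cod I x = i"
  by (auto simp: arrows_to_def)

lemma code_Lan:
  fixes X :: "('i, 'n, 'u) setftor" and i
  assumes X: "X \<in> Obj Families"
  defines "\<Sigma> \<equiv> Sigma (arrows_to I i) (\<lambda>x. fobj X (Dom I x))"
  shows "inj_on (code \<U> \<Sigma>) \<Sigma>" "code \<U> \<Sigma> ` \<Sigma> \<in> \<U>"
proof -
  obtain A h where A: "A \<in> \<U>" and h: "bij_betw h (Arr I) A"
    using small by (auto simp: small_category_def eqpoll_def)
  have "h ` arrows_to I i \<in> \<U>"
    using h by (intro subset_small[OF A]) (auto simp: bij_betw_def)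
  moreover have "arrows_to I i \<approx> h ` arrows_to I i"
    using h by (auto simp: eqpoll_def bij_betw_def intro!: exI[of _ h] intro: inj_on_subset)
  ultimately have "\<exists>c. inj_on c \<Sigma> \<and> c ` \<Sigma> \<in> \<U>"
    unfolding \<Sigma>_def using Families_at[OF X] by (intro Sigma_codable) (auto simp: Sets_simps)
  then have "inj_on (code \<U> \<Sigma>) \<Sigma> \<and> code \<U> \<Sigma> ` \<Sigma> \<in> \<U>"
    unfolding code_def by (rule someI_ex)
  then show "inj_on (code \<U> \<Sigma>) \<Sigma>" "code \<U> \<Sigma> ` \<Sigma> \<in> \<U>"
    by auto
qed

lemma Lan_set_Obj [simp]: "X \<in> Obj Families \<Longrightarrow> Lan_set \<U> I X i \<in> Obj S"
  using code_Lan(2)[of X i] by (simp add: Lan_set_def Coprod_def Sets_simps)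

lemma Lan_in_in:
  "x \<in> Arr I \<Longrightarrow> Cod I x = i \<Longrightarrow> a \<in> fobj X (Dom I x) \<Longrightarrow> Lan_in \<U> I X i x a \<in> Lan_set \<U> I X i"
  by (auto simp: Lan_in_def Lan_set_def inject_def Coprod_def)

lemma Lan_setE:
  assumes "z \<in> Lan_set \<U> I X i"
  obtains x a where "x \<in> Arr I" "Cod I x = i" "a \<in> fobj X (Dom I x)" "z = Lan_in \<U> I X i x a"
  using assms by (auto simp: Lan_in_def Lan_set_def inject_def Coprod_def)

lemma Lan_copair_in:
  assumes "X \<in> Obj Families" "x \<in> Arr I" "Cod I x = i" "a \<in> fobj X (Dom I x)"
  shows "Lan_copair \<U> I X i g (Lan_in \<U> I X i x a) = g x a"
  using the_inv_into_f_f[OF code_Lan(1)[OF assms(1), of i], of "(x, a)"] assms(2-)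
  by (auto simp: Lan_in_def Lan_copair_def inject_def copair_def Coprod_def)

lemma Lan_copair_extensional: "Lan_copair \<U> I X i g \<in> extensional (Lan_set \<U> I X i)"
  by (simp add: Lan_copair_def copair_def Lan_set_def)

text \<open>The coproduct maps as arrows of the category of sets. With the three lemmas
  \<open>cotuple_in\<close>, \<open>cotuple_summand\<close> and \<open>summands_jointly_epic\<close> the encoding of disjoint sums
  can be forgotten.\<close>

definition summand :: "('i, 'n, 'u) setftor \<Rightarrow> 'i \<Rightarrow> 'n \<Rightarrow> 'u setarr" where
  "summand X i x = \<lparr>src = fobj X (Dom I x), tgt = Lan_set \<U> I X i,
    fun_of = (\<lambda>a\<in>fobj X (Dom I x). Lan_in \<U> I X i x a)\<rparr>"

definition cotuple ::
  "('i, 'n, 'u) setftor \<Rightarrow> 'i \<Rightarrow> 'u set \<Rightarrow> ('n \<Rightarrow> 'u setarr) \<Rightarrow> 'u setarr" where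
  "cotuple X i Y g = \<lparr>src = Lan_set \<U> I X i, tgt = Y,
    fun_of = Lan_copair \<U> I X i (\<lambda>x a. fun_of (g x) a)\<rparr>"

lemma summand_in [simp]:
  assumes "X \<in> Obj Families" "x \<in> Arr I" "Cod I x = i"
  shows "summand X i x \<in> Arr S"
  using Lan_set_Obj[of X i] Families_at[of X "Dom I x"] assms
  by (auto simp: summand_def Sets_simps Sets_Arr_iff Lan_in_in)

lemma Dom_summand [simp]: "Dom S (summand X i x) = fobj X (Dom I x)"
  and Cod_summand [simp]: "Cod S (summand X i x) = Lan_set \<U> I X i"
  by (simp_all add: summand_def Sets_simps)

lemma Dom_cotuple [simp]: "Dom S (cotuple X i Y g) = Lan_set \<U> I X i"
  and Cod_cotuple [simp]: "Cod S (cotuple X i Y g) = Y"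
  by (simp_all add: cotuple_def Sets_simps)

lemma cotuple_in [simp]:
  assumes X: "X \<in> Obj Families" and Y: "Y \<in> Obj S"
    and g: "\<And>x. x \<in> Arr I \<Longrightarrow> Cod I x = i \<Longrightarrow> g x \<in> Arr S"
    "\<And>x. x \<in> Arr I \<Longrightarrow> Cod I x = i \<Longrightarrow> Dom S (g x) = fobj X (Dom I x)"
    "\<And>x. x \<in> Arr I \<Longrightarrow> Cod I x = i \<Longrightarrow> Cod S (g x) = Y"
  shows "cotuple X i Y g \<in> Arr S"
proof -
  have "Lan_copair \<U> I X i (\<lambda>x a. fun_of (g x) a) z \<in> Y" if "z \<in> Lan_set \<U> I X i" for z
    using that
  proof (rule Lan_setE)
    fix x a assume "x \<in> Arr I" "Cod I x = i" "a \<in> fobj X (Dom I x)" "z = Lan_in \<U> I X i x a"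
    then show ?thesis
      using g[of x] by (auto simp: Lan_copair_in[OF X] Sets_Arr_iff Sets_simps)
  qed
  then show ?thesis
    using X Y Lan_copair_extensional Lan_set_Obj[of X i]
    by (auto simp: cotuple_def Sets_Arr_iff Sets_simps PiE_def)
qed

lemma cotuple_summand:
  assumes X: "X \<in> Obj Families" and "x \<in> Arr I" "Cod I x = i"
    and "g x \<in> Arr S" "Dom S (g x) = fobj X (Dom I x)" "Cod S (g x) = Y"
  shows "cotuple X i Y g \<cdot>\<^bsub>S\<^esub> summand X i x = g x"
  using assms
  by (auto intro!: arrow_eqI extensionalityI[of _ "fobj X (Dom I x)"]
      simp: cotuple_def summand_def compose_def Lan_copair_in Sets_Arr_iff Sets_simps PiE_def)

lemma summands_jointly_epic:
  assumes X: "X \<in> Obj Families" and f: "f \<in> Arr S" "Dom S f = Lan_set \<U> I X i"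
    and g: "g \<in> Arr S" "Dom S g = Lan_set \<U> I X i" and "Cod S f = Cod S g"
    and eq: "\<And>x. x \<in> Arr I \<Longrightarrow> Cod I x = i \<Longrightarrow> f \<cdot>\<^bsub>S\<^esub> summand X i x = g \<cdot>\<^bsub>S\<^esub> summand X i x"
  shows "f = g"
proof (rule arrow_eqI)
  have "fun_of f z = fun_of g z" if "z \<in> Lan_set \<U> I X i" for z
    using that
  proof (rule Lan_setE)
    fix x a assume x: "x \<in> Arr I" "Cod I x = i" and a: "a \<in> fobj X (Dom I x)"
      and "z = Lan_in \<U> I X i x a"
    moreover have "fun_of (f \<cdot>\<^bsub>S\<^esub> summand X i x) a = fun_of (g \<cdot>\<^bsub>S\<^esub> summand X i x) a"
      using eq[OF x] by simp
    ultimately show ?thesis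
      by (simp add: summand_def compose_def Sets_simps)
  qed
  then show "fun_of f = fun_of g"
    using f g by (intro extensionalityI[of _ "Lan_set \<U> I X i"])
      (auto simp: Sets_Arr_iff Sets_simps PiE_def)
qed (use assms in \<open>simp_all add: Sets_simps\<close>)

lemma Lan_copair_cong:
  assumes X: "X \<in> Obj Families"
    and eq: "\<And>x a. x \<in> Arr I \<Longrightarrow> Cod I x = i \<Longrightarrow> a \<in> fobj X (Dom I x) \<Longrightarrow> g x a = g' x a"
  shows "Lan_copair \<U> I X i g = Lan_copair \<U> I X i g'"
proof (rule extensionalityI[OF Lan_copair_extensional Lan_copair_extensional])
  fix z assume "z \<in> Lan_set \<U> I X i"
  then show "Lan_copair \<U> I X i g z = Lan_copair \<U> I X i g' z"
    by (rule Lan_setE) (simp add: Lan_copair_in[OF X] eq)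
qed

end

section \<open>The left Kan extension\<close>

context small_diagrams
begin

abbreviation "Diagrams \<equiv> FunCat I S"

sublocale Diagrams: category Diagrams
  by (rule FunCat_category[OF I.category_axioms S.category_axioms])

lemma Families_ArrD:
  assumes "t \<in> Arr Families"
  shows "src t \<in> Obj Families" "tgt t \<in> Obj Families" "fun_of t \<in> extensional (Obj I)"
    and "i \<in> Obj I \<Longrightarrow> fun_of t i \<in> Arr S"
    and "i \<in> Obj I \<Longrightarrow> Dom S (fun_of t i) = fobj (src t) i"
    and "i \<in> Obj I \<Longrightarrow> Cod S (fun_of t i) = fobj (tgt t) i"
  using FunCat_ArrD[OF assms] by simp_all

lemma Families_is_isoI:
  assumes t: "t \<in> Arr Families" and iso: "\<And>i. i \<in> Obj I \<Longrightarrow> is_iso S (fun_of t i)"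
  shows "is_iso Families t"
proof -
  note t' = Families_ArrD[OF t]
  have "\<exists>k. k \<in> Arr S \<and> Dom S k = fobj (tgt t) i \<and> Cod S k = fobj (src t) i
      \<and> k \<cdot>\<^bsub>S\<^esub> fun_of t i = Id S (fobj (src t) i) \<and> fun_of t i \<cdot>\<^bsub>S\<^esub> k = Id S (fobj (tgt t) i)"
    if i: "i \<in> Obj I" for i
    using S.is_isoE[OF iso[OF i]] t'(4-6)[OF i] by metis
  then obtain k where "\<And>i. i \<in> Obj I \<Longrightarrow> k i \<in> Arr S \<and> Dom S (k i) = fobj (tgt t) i
      \<and> Cod S (k i) = fobj (src t) i \<and> k i \<cdot>\<^bsub>S\<^esub> fun_of t i = Id S (fobj (src t) i)
      \<and> fun_of t i \<cdot>\<^bsub>S\<^esub> k i = Id S (fobj (tgt t) i)"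
    by metis
  then have k: "k i \<in> Arr S" "Dom S (k i) = fobj (tgt t) i" "Cod S (k i) = fobj (src t) i"
    "k i \<cdot>\<^bsub>S\<^esub> fun_of t i = Id S (fobj (src t) i)" "fun_of t i \<cdot>\<^bsub>S\<^esub> k i = Id S (fobj (tgt t) i)"
    if "i \<in> Obj I" for i
    using that by auto
  let ?s = "\<lparr>src = tgt t, tgt = src t, fun_of = (\<lambda>i\<in>Obj I. k i)\<rparr>"
  have "?s \<in> Arr Families"
    using t' k by (intro FunCat_discrete_ArrI I.category_axioms S.category_axioms) simp_all
  then show ?thesis
    using t k by (intro Families.is_isoI[of _ ?s]) (auto intro!: arrow_eqI restrict_ext)
qed

lemma fobj_Lan_obj [simp]: "i \<in> Obj I \<Longrightarrow> fobj (Lan_obj \<U> I X) i = Lan_set \<U> I X i"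
  by (simp add: Lan_obj_def)

text \<open>From here on the structure maps of the Kan extension are cotuples; they are used only through
  their values on summands.\<close>

lemma farr_Lan_obj:
  assumes X: "X \<in> Obj Families" and f: "f \<in> Arr I"
  shows "farr (Lan_obj \<U> I X) f
    = cotuple X (Dom I f) (Lan_set \<U> I X (Cod I f)) (\<lambda>x. summand X (Cod I f) (f \<cdot>\<^bsub>I\<^esub> x))"
  using f by (auto intro!: arrow_eqI Lan_copair_cong[OF X] simp: Lan_obj_def cotuple_def summand_def)

lemma farr_Lan_obj_in [simp]:
  assumes "X \<in> Obj Families" "f \<in> Arr I"
  shows "farr (Lan_obj \<U> I X) f \<in> Arr S"
    and "Dom S (farr (Lan_obj \<U> I X) f) = Lan_set \<U> I X (Dom I f)"
    and "Cod S (farr (Lan_obj \<U> I X) f) = Lan_set \<U> I X (Cod I f)"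
  using assms by (simp_all add: farr_Lan_obj)

lemma farr_Lan_obj_summand:
  assumes "X \<in> Obj Families" "f \<in> Arr I" "x \<in> Arr I" "Cod I x = Dom I f"
  shows "farr (Lan_obj \<U> I X) f \<cdot>\<^bsub>S\<^esub> summand X (Dom I f) x = summand X (Cod I f) (f \<cdot>\<^bsub>I\<^esub> x)"
  using assms by (simp add: farr_Lan_obj cotuple_summand)

lemma Lan_obj_Obj [simp]:
  assumes X: "X \<in> Obj Families"
  shows "Lan_obj \<U> I X \<in> Obj Diagrams"
proof (rule FunCat_ObjI)
  show "is_functor I S (Lan_obj \<U> I X)"
  proof (rule is_functorI)
    fix i assume i: "i \<in> Obj I"
    then show "farr (Lan_obj \<U> I X) (Id I i) = Id S (fobj (Lan_obj \<U> I X) i)"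
      using X farr_Lan_obj_summand[OF X, of "Id I i"]
      by - (rule summands_jointly_epic[OF X, of _ i], auto simp: I.Comp_Id_left' S.Comp_Id_left')
  next
    fix f g assume fg: "f \<in> Arr I" "g \<in> Arr I" "Cod I f = Dom I g"
    show "farr (Lan_obj \<U> I X) (g \<cdot>\<^bsub>I\<^esub> f)
        = farr (Lan_obj \<U> I X) g \<cdot>\<^bsub>S\<^esub> farr (Lan_obj \<U> I X) f"
    proof (rule summands_jointly_epic[OF X, of _ "Dom I f"])
      fix x assume x: "x \<in> Arr I" "Cod I x = Dom I f"
      show "farr (Lan_obj \<U> I X) (g \<cdot>\<^bsub>I\<^esub> f) \<cdot>\<^bsub>S\<^esub> summand X (Dom I f) x
          = (farr (Lan_obj \<U> I X) g \<cdot>\<^bsub>S\<^esub> farr (Lan_obj \<U> I X) f) \<cdot>\<^bsub>S\<^esub> summand X (Dom I f) x"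
        using X fg x farr_Lan_obj_summand[OF X, of "g \<cdot>\<^bsub>I\<^esub> f" x]
          farr_Lan_obj_summand[OF X, of g "f \<cdot>\<^bsub>I\<^esub> x"]
        by (simp add: S.Comp_right_assoc farr_Lan_obj_summand I.Comp_right_assoc)
    qed (use X fg in simp_all)
  qed (use X in \<open>simp_all add: I.category_axioms S.category_axioms\<close>)
qed (simp_all add: Lan_obj_def)

lemma Lan_simps [simp]:
  "fobj (Lan \<U> I) X = Lan_obj \<U> I X"
  "src (farr (Lan \<U> I) t) = Lan_obj \<U> I (src t)"
  "tgt (farr (Lan \<U> I) t) = Lan_obj \<U> I (tgt t)"
  by (simp_all add: Lan_def)

lemma farr_Lan:
  assumes t: "t \<in> Arr Families" and i: "i \<in> Obj I"
  shows "fun_of (farr (Lan \<U> I) t) i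
    = cotuple (src t) i (Lan_set \<U> I (tgt t) i) (\<lambda>x. summand (tgt t) i x \<cdot>\<^bsub>S\<^esub> fun_of t (Dom I x))"
proof -
  note t' = Families_ArrD[OF t]
  have "Lan_in \<U> I (tgt t) i x (fun_of (fun_of t (Dom I x)) a)
      = fun_of (summand (tgt t) i x \<cdot>\<^bsub>S\<^esub> fun_of t (Dom I x)) a"
    if "x \<in> Arr I" "Cod I x = i" "a \<in> fobj (src t) (Dom I x)" for x a
    using t'(4-6)[of "Dom I x"] that
    by (auto simp: summand_def compose_def Sets_simps Sets_Arr_iff)
  then show ?thesis
    using i by (auto intro!: arrow_eqI Lan_copair_cong[OF t'(1)] simp: Lan_def cotuple_def)
qed

lemma farr_Lan_in [simp]:
  assumes t: "t \<in> Arr Families" and i: "i \<in> Obj I"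
  shows "fun_of (farr (Lan \<U> I) t) i \<in> Arr S"
    and "Dom S (fun_of (farr (Lan \<U> I) t) i) = Lan_set \<U> I (src t) i"
    and "Cod S (fun_of (farr (Lan \<U> I) t) i) = Lan_set \<U> I (tgt t) i"
  using assms Families_ArrD[OF t] by (simp_all add: farr_Lan)

lemma farr_Lan_summand:
  assumes t: "t \<in> Arr Families" and x: "x \<in> Arr I" "Cod I x = i"
  shows "fun_of (farr (Lan \<U> I) t) i \<cdot>\<^bsub>S\<^esub> summand (src t) i x
    = summand (tgt t) i x \<cdot>\<^bsub>S\<^esub> fun_of t (Dom I x)"
proof -
  have "i \<in> Obj I"
    using x by auto
  then show ?thesis
    using Families_ArrD[OF t] x by (simp add: farr_Lan[OF t] cotuple_summand)
qed

lemma Lan_functor: "is_functor Families Diagrams (Lan \<U> I)"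
proof (rule is_functorI)
  fix t assume t: "t \<in> Arr Families"
  note t' = Families_ArrD[OF t]
  show "farr (Lan \<U> I) t \<in> Arr Diagrams"
  proof (rule FunCat_ArrI)
    fix f assume f: "f \<in> Arr I"
    have "fun_of (farr (Lan \<U> I) t) (Cod I f) \<cdot>\<^bsub>S\<^esub> farr (Lan_obj \<U> I (src t)) f
        = farr (Lan_obj \<U> I (tgt t)) f \<cdot>\<^bsub>S\<^esub> fun_of (farr (Lan \<U> I) t) (Dom I f)"
    proof (rule summands_jointly_epic[OF t'(1), of _ "Dom I f"])
      fix x assume x: "x \<in> Arr I" "Cod I x = Dom I f"
      show "(fun_of (farr (Lan \<U> I) t) (Cod I f) \<cdot>\<^bsub>S\<^esub> farr (Lan_obj \<U> I (src t)) f)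
            \<cdot>\<^bsub>S\<^esub> summand (src t) (Dom I f) x
          = (farr (Lan_obj \<U> I (tgt t)) f \<cdot>\<^bsub>S\<^esub> fun_of (farr (Lan \<U> I) t) (Dom I f))
            \<cdot>\<^bsub>S\<^esub> summand (src t) (Dom I f) x"
        using t t' x f
        by (simp add: S.Comp_right_assoc farr_Lan_summand farr_Lan_obj_summand
            S.Comp_front[OF farr_Lan_obj_summand])
    qed (use t t' f in simp_all)
    then show "fun_of (farr (Lan \<U> I) t) (Cod I f) \<cdot>\<^bsub>S\<^esub> farr (src (farr (Lan \<U> I) t)) f
        = farr (tgt (farr (Lan \<U> I) t)) f \<cdot>\<^bsub>S\<^esub> fun_of (farr (Lan \<U> I) t) (Dom I f)"
      by simp
  qed (use t t' in simp_all, simp add: Lan_def)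
next
  fix X assume X: "X \<in> Obj Families"
  have "fun_of (farr (Lan \<U> I) (Id Families X)) i = Id S (Lan_set \<U> I X i)" if i: "i \<in> Obj I" for i
    using X i Families.Id_in[OF X] farr_Lan_summand[OF Families.Id_in[OF X], of _ i]
    by - (rule summands_jointly_epic[OF X, of _ i],
        auto simp: S.Comp_Id_left' S.Comp_Id_right' simp del: Families.Id_in)
  then show "farr (Lan \<U> I) (Id Families X) = Id Diagrams (fobj (Lan \<U> I) X)"
    using X by (auto intro!: arrow_eqI extensionalityI[of _ "Obj I"] simp: Lan_def)
next
  fix s t assume s: "s \<in> Arr Families" and t: "t \<in> Arr Families"
    and "Cod Families s = Dom Families t"
  then have st: "tgt s = src t" and ts: "t \<cdot>\<^bsub>Families\<^esub> s \<in> Arr Families"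
    by (simp, intro Families.Comp_in)
  note s' = Families_ArrD[OF s] and t' = Families_ArrD[OF t]
  have "fun_of (farr (Lan \<U> I) (t \<cdot>\<^bsub>Families\<^esub> s)) i
      = fun_of (farr (Lan \<U> I) t) i \<cdot>\<^bsub>S\<^esub> fun_of (farr (Lan \<U> I) s) i" if i: "i \<in> Obj I" for i
  proof (rule summands_jointly_epic[OF s'(1), of _ i])
    fix x assume x: "x \<in> Arr I" "Cod I x = i"
    show "fun_of (farr (Lan \<U> I) (t \<cdot>\<^bsub>Families\<^esub> s)) i \<cdot>\<^bsub>S\<^esub> summand (src s) i x
        = (fun_of (farr (Lan \<U> I) t) i \<cdot>\<^bsub>S\<^esub> fun_of (farr (Lan \<U> I) s) i) \<cdot>\<^bsub>S\<^esub> summand (src s) i x"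
      using s t s' t' st x i farr_Lan_summand[OF ts x] farr_Lan_summand[OF t x]
      by (simp add: S.Comp_right_assoc farr_Lan_summand S.Comp_front[OF farr_Lan_summand[OF t x]])
  qed (use s t s' t' st i farr_Lan_in[OF ts i] in simp_all)
  then show "farr (Lan \<U> I) (t \<cdot>\<^bsub>Families\<^esub> s) = farr (Lan \<U> I) t \<cdot>\<^bsub>Diagrams\<^esub> farr (Lan \<U> I) s"
    by (auto intro!: arrow_eqI extensionalityI[of _ "Obj I"] simp: Lan_def)
qed (simp_all add: Families.category_axioms Diagrams.category_axioms)

end

section \<open>The adjunction on diagrams\<close>

locale diagram_adjunction = small_diagrams \<U> I + adjunction "Sets \<U>" C F U \<eta> \<epsilon>
  for \<U> :: "'u set set" and I :: "('i, 'n) cat" and C :: "('o, 'm) cat"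
    and F :: "('u set, 'u setarr, 'o, 'm) ftor" and U :: "('o, 'm, 'u set, 'u setarr) ftor"
    and \<eta> \<epsilon>
begin

abbreviation "CI \<equiv> FunCat I C"
abbreviation "FI \<equiv> F_I \<U> I F"
abbreviation "UI \<equiv> U_I I U"
abbreviation "\<eta>I \<equiv> unit_I \<U> I F U \<eta>"
abbreviation "\<epsilon>I \<equiv> counit_I \<U> I C F U \<epsilon>"

sublocale CI: category CI
  by (rule FunCat_category[OF I.category_axioms L.D.category_axioms])

lemma FI_functor: "is_functor Families CI FI"
  unfolding F_I_def
  by (rule comp_ftor_functor[OF Lan_functor
        postcomp_functor[OF I.category_axioms I.category_axioms L.is_functor_axioms]]) simp_all

lemma UI_functor: "is_functor CI Families UI"
  unfolding U_I_def
  by (rule postcomp_functor[OF I.category_axioms discrete_category[OF I.category_axioms]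
        V.is_functor_axioms]) auto

sublocale FI: is_functor Families CI FI
  by (rule FI_functor)

sublocale UI: is_functor CI Families UI
  by (rule UI_functor)

lemma FI_simps [simp]:
  "i \<in> Obj I \<Longrightarrow> fobj (fobj FI X) i = fobj F (Lan_set \<U> I X i)"
  "f \<in> Arr I \<Longrightarrow> farr (fobj FI X) f = farr F (farr (Lan_obj \<U> I X) f)"
  "src (farr FI t) = fobj FI (src t)"
  "tgt (farr FI t) = fobj FI (tgt t)"
  "i \<in> Obj I \<Longrightarrow> fun_of (farr FI t) i = farr F (fun_of (farr (Lan \<U> I) t) i)"
  by (simp_all add: F_I_def)

lemma UI_simps [simp]:
  "i \<in> Obj I \<Longrightarrow> fobj (fobj UI A) i = fobj U (fobj A i)"
  "src (farr UI t) = fobj UI (src t)"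
  "tgt (farr UI t) = fobj UI (tgt t)"
  "i \<in> Obj I \<Longrightarrow> fun_of (farr UI t) i = farr U (fun_of t i)"
  by (simp_all add: U_I_def)

lemmas CI_at [simp] = FunCat_Obj_at[of _ I C]

text \<open>The action of \<open>I\<close> on the underlying sets of a diagram \<open>A\<close>, gathered into one map
  \<open>\<Coprod>\<^bsub>x \<rightarrow> i\<^esub> U (A (Dom x)) \<rightarrow> U (A i)\<close>.\<close>

definition act :: "('i, 'n, 'o, 'm) ftor \<Rightarrow> 'i \<Rightarrow> 'u setarr" where
  "act A i = cotuple (fobj UI A) i (fobj U (fobj A i)) (\<lambda>x. farr U (farr A x))"

lemma act_in [simp]:
  assumes "A \<in> Obj CI" "i \<in> Obj I"
  shows "act A i \<in> Arr S" "Dom S (act A i) = Lan_set \<U> I (fobj UI A) i"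
    "Cod S (act A i) = fobj U (fobj A i)"
  using assms unfolding act_def by (auto intro!: cotuple_in)

lemma act_summand:
  assumes "A \<in> Obj CI" "x \<in> Arr I" "Cod I x = i"
  shows "act A i \<cdot>\<^bsub>S\<^esub> summand (fobj UI A) i x = farr U (farr A x)"
  using assms unfolding act_def by (intro cotuple_summand) auto

text \<open>Functoriality of \<open>A\<close>, read on the summand of \<open>x\<close>.\<close>

lemma act_natural_index:
  assumes A: "A \<in> Obj CI" and f: "f \<in> Arr I"
  shows "act A (Cod I f) \<cdot>\<^bsub>S\<^esub> farr (Lan_obj \<U> I (fobj UI A)) f
    = farr U (farr A f) \<cdot>\<^bsub>S\<^esub> act A (Dom I f)"
proof (rule summands_jointly_epic[of "fobj UI A" _ "Dom I f"])
  fix x assume x: "x \<in> Arr I" "Cod I x = Dom I f"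
  show "(act A (Cod I f) \<cdot>\<^bsub>S\<^esub> farr (Lan_obj \<U> I (fobj UI A)) f) \<cdot>\<^bsub>S\<^esub> summand (fobj UI A) (Dom I f) x
      = (farr U (farr A f) \<cdot>\<^bsub>S\<^esub> act A (Dom I f)) \<cdot>\<^bsub>S\<^esub> summand (fobj UI A) (Dom I f) x"
    using A f x
    by (simp add: S.Comp_right_assoc farr_Lan_obj_summand act_summand FunCat_Obj_Comp[OF A]
        V.farr_Comp)
qed (use A f in simp_all)

text \<open>Naturality of \<open>t\<close> at \<open>x\<close>, read on the summand of \<open>x\<close>.\<close>

lemma act_natural:
  assumes t: "t \<in> Arr CI" and i: "i \<in> Obj I"
  shows "act (tgt t) i \<cdot>\<^bsub>S\<^esub> fun_of (farr (Lan \<U> I) (farr UI t)) i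
    = farr U (fun_of t i) \<cdot>\<^bsub>S\<^esub> act (src t) i"
proof -
  note t' = FunCat_ArrD[OF t]
  have Ut: "farr UI t \<in> Arr Families"
    using t by (rule UI.farr_in)
  show ?thesis
  proof (rule summands_jointly_epic[of "fobj UI (src t)" _ i])
    fix x assume x: "x \<in> Arr I" "Cod I x = i"
    show "(act (tgt t) i \<cdot>\<^bsub>S\<^esub> fun_of (farr (Lan \<U> I) (farr UI t)) i) \<cdot>\<^bsub>S\<^esub> summand (fobj UI (src t)) i x
        = (farr U (fun_of t i) \<cdot>\<^bsub>S\<^esub> act (src t) i) \<cdot>\<^bsub>S\<^esub> summand (fobj UI (src t)) i x"
      using t' Ut x i farr_Lan_summand[OF Ut x] t'(7)[OF x(1)]
      by (simp add: S.Comp_right_assoc act_summand S.Comp_front[OF act_summand] flip: V.farr_Comp)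
  qed (use t' Ut i in simp_all)
qed

lemma counit_I_simps [simp]:
  "src (\<epsilon>I A) = fobj FI (fobj UI A)"
  "tgt (\<epsilon>I A) = A"
  "i \<in> Obj I \<Longrightarrow> fun_of (\<epsilon>I A) i = \<epsilon> (fobj A i) \<cdot>\<^bsub>C\<^esub> farr F (act A i)"
  "fun_of (\<epsilon>I A) \<in> extensional (Obj I)"
  by (simp_all add: counit_I_def act_def cotuple_def)

lemma unit_I_simps [simp]:
  "src (\<eta>I X) = X"
  "tgt (\<eta>I X) = fobj UI (fobj FI X)"
  "i \<in> Obj I \<Longrightarrow> fun_of (\<eta>I X) i = \<eta> (Lan_set \<U> I X i) \<cdot>\<^bsub>S\<^esub> summand X i (Id I i)"
  "fun_of (\<eta>I X) \<in> extensional (Obj I)"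
  by (simp_all add: unit_I_def summand_def)

lemma unit_I_Arr [simp]:
  assumes X: "X \<in> Obj Families"
  shows "\<eta>I X \<in> Arr Families"
  using X by (intro FunCat_discrete_ArrI I.category_axioms S.category_axioms) simp_all

lemma counit_I_Arr [simp]:
  assumes A: "A \<in> Obj CI"
  shows "\<epsilon>I A \<in> Arr CI"
proof (rule FunCat_ArrI)
  fix f assume f: "f \<in> Arr I"
  have nat: "\<epsilon> (fobj A (Cod I f)) \<cdot>\<^bsub>C\<^esub> farr F (farr U (farr A f))
      = farr A f \<cdot>\<^bsub>C\<^esub> \<epsilon> (fobj A (Dom I f))"
    using A f counit_natural[of "farr A f"] by simp
  have "(\<epsilon> (fobj A (Cod I f)) \<cdot>\<^bsub>C\<^esub> farr F (act A (Cod I f)))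
      \<cdot>\<^bsub>C\<^esub> farr F (farr (Lan_obj \<U> I (fobj UI A)) f)
      = \<epsilon> (fobj A (Cod I f)) \<cdot>\<^bsub>C\<^esub> farr F (farr U (farr A f) \<cdot>\<^bsub>S\<^esub> act A (Dom I f))"
    using A f by (simp add: L.D.Comp_right_assoc act_natural_index flip: L.farr_Comp)
  also have "\<dots> = farr A f \<cdot>\<^bsub>C\<^esub> (\<epsilon> (fobj A (Dom I f)) \<cdot>\<^bsub>C\<^esub> farr F (act A (Dom I f)))"
    using A f by (simp add: L.farr_Comp L.D.Comp_right_assoc L.D.Comp_front[OF nat])
  finally show "fun_of (\<epsilon>I A) (Cod I f) \<cdot>\<^bsub>C\<^esub> farr (src (\<epsilon>I A)) f
      = farr (tgt (\<epsilon>I A)) f \<cdot>\<^bsub>C\<^esub> fun_of (\<epsilon>I A) (Dom I f)"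
    using f by simp
qed (use A in simp_all)

text \<open>This reduces the first triangle identity on diagrams to the one for \<open>F\<close> and \<open>U\<close>. On the summand
  of \<open>x\<close> the left side inserts into the summand of the identity of \<open>Dom x\<close> and then moves
  along \<open>x\<close>, which lands in the summand of \<open>x \<cdot> Id = x\<close>.\<close>

lemma act_Lan_unit:
  assumes X: "X \<in> Obj Families" and i: "i \<in> Obj I"
  shows "act (fobj FI X) i \<cdot>\<^bsub>S\<^esub> fun_of (farr (Lan \<U> I) (\<eta>I X)) i = \<eta> (Lan_set \<U> I X i)"
proof (rule summands_jointly_epic[OF X, of _ i])
  fix x assume x: "x \<in> Arr I" "Cod I x = i"
  have nat: "farr U (farr F (farr (Lan_obj \<U> I X) x)) \<cdot>\<^bsub>S\<^esub> \<eta> (Lan_set \<U> I X (Dom I x))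
      = \<eta> (Lan_set \<U> I X i) \<cdot>\<^bsub>S\<^esub> farr (Lan_obj \<U> I X) x"
    using X x unit_natural[of "farr (Lan_obj \<U> I X) x"] by simp
  have "(act (fobj FI X) i \<cdot>\<^bsub>S\<^esub> fun_of (farr (Lan \<U> I) (\<eta>I X)) i) \<cdot>\<^bsub>S\<^esub> summand X i x
      = farr U (farr F (farr (Lan_obj \<U> I X) x)) \<cdot>\<^bsub>S\<^esub>
        (\<eta> (Lan_set \<U> I X (Dom I x)) \<cdot>\<^bsub>S\<^esub> summand X (Dom I x) (Id I (Dom I x)))"
    using X x i farr_Lan_summand[OF unit_I_Arr[OF X] x]
    by (simp add: S.Comp_right_assoc S.Comp_front[OF act_summand])
  also have "\<dots> = \<eta> (Lan_set \<U> I X i) \<cdot>\<^bsub>S\<^esub>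
      (farr (Lan_obj \<U> I X) x \<cdot>\<^bsub>S\<^esub> summand X (Dom I x) (Id I (Dom I x)))"
    using X x i by (simp add: S.Comp_front[OF nat] S.Comp_right_assoc)
  also have "\<dots> = \<eta> (Lan_set \<U> I X i) \<cdot>\<^bsub>S\<^esub> summand X i x"
    using X x i by (simp add: farr_Lan_obj_summand)
  finally show "(act (fobj FI X) i \<cdot>\<^bsub>S\<^esub> fun_of (farr (Lan \<U> I) (\<eta>I X)) i) \<cdot>\<^bsub>S\<^esub> summand X i x
      = \<eta> (Lan_set \<U> I X i) \<cdot>\<^bsub>S\<^esub> summand X i x" .
qed (use X i in simp_all)

lemma unit_I_nat_trans: "nat_trans Families Families id_ftor (comp_ftor UI FI) \<eta>I"
proof (rule nat_transI)
  fix t assume t: "t \<in> Arr Families"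
  note t' = Families_ArrD[OF t]
  have nat: "farr U (farr F (fun_of (farr (Lan \<U> I) t) i)) \<cdot>\<^bsub>S\<^esub> \<eta> (Lan_set \<U> I (src t) i)
      = \<eta> (Lan_set \<U> I (tgt t) i) \<cdot>\<^bsub>S\<^esub> fun_of (farr (Lan \<U> I) t) i" if "i \<in> Obj I" for i
    using that t t' unit_natural[of "fun_of (farr (Lan \<U> I) t) i"] by simp
  have "(\<eta> (Lan_set \<U> I (tgt t) i) \<cdot>\<^bsub>S\<^esub> summand (tgt t) i (Id I i)) \<cdot>\<^bsub>S\<^esub> fun_of t i
      = farr U (farr F (fun_of (farr (Lan \<U> I) t) i)) \<cdot>\<^bsub>S\<^esub>
        (\<eta> (Lan_set \<U> I (src t) i) \<cdot>\<^bsub>S\<^esub> summand (src t) i (Id I i))" if i: "i \<in> Obj I" for i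
    using i t t' farr_Lan_summand[OF t, of "Id I i" i]
    by (simp add: S.Comp_front[OF nat[OF i]] S.Comp_right_assoc)
  then show "\<eta>I (Cod Families t) \<cdot>\<^bsub>Families\<^esub> farr id_ftor t
      = farr (comp_ftor UI FI) t \<cdot>\<^bsub>Families\<^esub> \<eta>I (Dom Families t)"
    by (auto intro!: arrow_eqI extensionalityI[of _ "Obj I"])
qed (simp_all add: Families.id_ftor_functor comp_ftor_functor[OF FI_functor UI_functor])

lemma counit_I_nat_trans: "nat_trans CI CI (comp_ftor FI UI) id_ftor \<epsilon>I"
proof (rule nat_transI)
  fix t assume t: "t \<in> Arr CI"
  note t' = FunCat_ArrD[OF t]
  have "(\<epsilon> (fobj (tgt t) i) \<cdot>\<^bsub>C\<^esub> farr F (act (tgt t) i))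
        \<cdot>\<^bsub>C\<^esub> farr F (fun_of (farr (Lan \<U> I) (farr UI t)) i)
      = fun_of t i \<cdot>\<^bsub>C\<^esub> (\<epsilon> (fobj (src t) i) \<cdot>\<^bsub>C\<^esub> farr F (act (src t) i))" if i: "i \<in> Obj I" for i
  proof -
    have Ut: "farr UI t \<in> Arr Families"
      using t by (rule UI.farr_in)
    have nat: "\<epsilon> (fobj (tgt t) i) \<cdot>\<^bsub>C\<^esub> farr F (farr U (fun_of t i))
        = fun_of t i \<cdot>\<^bsub>C\<^esub> \<epsilon> (fobj (src t) i)"
      using t' i counit_natural[of "fun_of t i"] by simp
    have "(\<epsilon> (fobj (tgt t) i) \<cdot>\<^bsub>C\<^esub> farr F (act (tgt t) i))
          \<cdot>\<^bsub>C\<^esub> farr F (fun_of (farr (Lan \<U> I) (farr UI t)) i)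
        = \<epsilon> (fobj (tgt t) i) \<cdot>\<^bsub>C\<^esub> farr F (farr U (fun_of t i) \<cdot>\<^bsub>S\<^esub> act (src t) i)"
      using t t' i Ut by (simp add: L.D.Comp_right_assoc act_natural flip: L.farr_Comp)
    also have "\<dots> = fun_of t i \<cdot>\<^bsub>C\<^esub> (\<epsilon> (fobj (src t) i) \<cdot>\<^bsub>C\<^esub> farr F (act (src t) i))"
      using t' i by (simp add: L.farr_Comp L.D.Comp_right_assoc L.D.Comp_front[OF nat])
    finally show ?thesis .
  qed
  then show "\<epsilon>I (Cod CI t) \<cdot>\<^bsub>CI\<^esub> farr (comp_ftor FI UI) t
      = farr id_ftor t \<cdot>\<^bsub>CI\<^esub> \<epsilon>I (Dom CI t)"
    by (auto intro!: arrow_eqI extensionalityI[of _ "Obj I"])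
qed (simp_all add: CI.id_ftor_functor comp_ftor_functor[OF UI_functor FI_functor])

lemma adjunction_I: "adjunction Families CI FI UI \<eta>I \<epsilon>I"
proof -
  interpret unit: nat_trans Families Families id_ftor "comp_ftor UI FI" \<eta>I
    by (rule unit_I_nat_trans)
  interpret counit: nat_trans CI CI "comp_ftor FI UI" id_ftor \<epsilon>I
    by (rule counit_I_nat_trans)
  show ?thesis
  proof
    fix X assume X: "X \<in> Obj Families"
    have "(\<epsilon> (fobj F (Lan_set \<U> I X i)) \<cdot>\<^bsub>C\<^esub> farr F (act (fobj FI X) i))
        \<cdot>\<^bsub>C\<^esub> farr F (fun_of (farr (Lan \<U> I) (\<eta>I X)) i) = Id C (fobj F (Lan_set \<U> I X i))"
      if i: "i \<in> Obj I" for i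
      using X i
      by (simp add: L.D.Comp_right_assoc act_Lan_unit triangle_left flip: L.farr_Comp)
    then show "\<epsilon>I (fobj FI X) \<cdot>\<^bsub>CI\<^esub> farr FI (\<eta>I X) = Id CI (fobj FI X)"
      by (auto intro!: arrow_eqI extensionalityI[of _ "Obj I"])
  next
    fix A assume A: "A \<in> Obj CI"
    have "farr U (\<epsilon> (fobj A i) \<cdot>\<^bsub>C\<^esub> farr F (act A i)) \<cdot>\<^bsub>S\<^esub>
        (\<eta> (Lan_set \<U> I (fobj UI A) i) \<cdot>\<^bsub>S\<^esub> summand (fobj UI A) i (Id I i))
        = Id S (fobj U (fobj A i))" if i: "i \<in> Obj I" for i
    proof -
      have nat: "farr U (farr F (act A i)) \<cdot>\<^bsub>S\<^esub> \<eta> (Lan_set \<U> I (fobj UI A) i)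
          = \<eta> (fobj U (fobj A i)) \<cdot>\<^bsub>S\<^esub> act A i"
        using A i unit_natural[of "act A i"] by simp
      have "farr U (\<epsilon> (fobj A i) \<cdot>\<^bsub>C\<^esub> farr F (act A i)) \<cdot>\<^bsub>S\<^esub>
          (\<eta> (Lan_set \<U> I (fobj UI A) i) \<cdot>\<^bsub>S\<^esub> summand (fobj UI A) i (Id I i))
          = farr U (\<epsilon> (fobj A i)) \<cdot>\<^bsub>S\<^esub> (\<eta> (fobj U (fobj A i)) \<cdot>\<^bsub>S\<^esub>
            (act A i \<cdot>\<^bsub>S\<^esub> summand (fobj UI A) i (Id I i)))"
        using A i by (simp add: V.farr_Comp S.Comp_right_assoc S.Comp_front[OF nat])
      also have "\<dots> = Id S (fobj U (fobj A i))"
        using A i by (simp add: act_summand S.Comp_Id_right' triangle_right)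
      finally show ?thesis .
    qed
    then show "farr UI (\<epsilon>I A) \<cdot>\<^bsub>Families\<^esub> \<eta>I (fobj UI A) = Id Families (fobj UI A)"
      by (auto intro!: arrow_eqI extensionalityI[of _ "Obj I"])
  qed
qed

end

section \<open>The comparison functor on diagrams is fully faithful\<close>

context diagram_adjunction
begin

sublocale adjI: adjunction Families CI FI UI \<eta>I \<epsilon>I
  by (rule adjunction_I)

abbreviation "Algs \<equiv> adj_Alg S F U \<eta> \<epsilon>"
abbreviation "AlgsI \<equiv> adj_Alg Families FI UI \<eta>I \<epsilon>I"
abbreviation "K \<equiv> comparison C U \<epsilon>"
abbreviation "KI \<equiv> comparison CI UI \<epsilon>I"

text \<open>The homomorphism law \<open>hom_at\<close> of \<open>\<gamma>\<close> is an identity between maps out of \<open>T (Lan (U A) i)\<close>. Its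
  restriction along \<open>T\<close> of the summand of the identity says that \<open>\<gamma> i\<close> is a homomorphism of
  \<open>T\<close>-algebras, so that it lifts to \<open>C\<close>; its restriction along \<open>\<eta>\<close> says that the \<open>\<gamma> i\<close> are
  natural in \<open>i\<close>, and naturality of the lifts follows by faithfulness of \<open>U\<close>.\<close>

lemma comparison_I_fully_faithful:
  assumes monadic: "monadic S C F U \<eta> \<epsilon>"
  shows "fully_faithful CI AlgsI KI"
  unfolding fully_faithful_def
proof (intro ballI)
  note faithful = monadic_faithful[OF monadic]
  fix A B g
  assume A: "A \<in> Obj CI" and B: "B \<in> Obj CI" and g: "g \<in> Hom AlgsI (fobj KI A) (fobj KI B)"
  then have g': "g \<in> Arr AlgsI" "src g = fobj KI A" "tgt g = fobj KI B"
    by (simp_all add: Hom_def adj_Alg_def)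
  define \<gamma> where "\<gamma> = fun_of g"
  have \<gamma>: "\<gamma> \<in> Arr Families" "src \<gamma> = fobj UI A" "tgt \<gamma> = fobj UI B"
    and hom: "\<gamma> \<cdot>\<^bsub>Families\<^esub> farr UI (\<epsilon>I A) = farr UI (\<epsilon>I B) \<cdot>\<^bsub>Families\<^esub> farr UI (farr FI \<gamma>)"
    using Alg_ArrD[OF g'(1)[unfolded adj_Alg_def]] g' by (simp_all add: \<gamma>_def)
  note \<gamma>_at [simp] = Families_ArrD(4-6)[OF \<gamma>(1), unfolded \<gamma>(2,3)]
  have hom_at: "fun_of \<gamma> i \<cdot>\<^bsub>S\<^esub> (farr U (\<epsilon> (fobj A i)) \<cdot>\<^bsub>S\<^esub> farr U (farr F (act A i)))
      = farr U (\<epsilon> (fobj B i)) \<cdot>\<^bsub>S\<^esub> farr U (farr F (act B i \<cdot>\<^bsub>S\<^esub> fun_of (farr (Lan \<U> I) \<gamma>) i))"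
    if i: "i \<in> Obj I" for i
    using arg_cong[OF hom, of "\<lambda>t. fun_of t i"] i A B \<gamma>
    by (simp add: V.farr_Comp L.farr_Comp S.Comp_right_assoc)
  have LanA: "fun_of (farr (Lan \<U> I) \<gamma>) i \<cdot>\<^bsub>S\<^esub> summand (fobj UI A) i x
      = summand (fobj UI B) i x \<cdot>\<^bsub>S\<^esub> fun_of \<gamma> (Dom I x)" if "x \<in> Arr I" "Cod I x = i" for i x
    using farr_Lan_summand[OF \<gamma>(1) that] \<gamma> by simp
  \<comment> \<open>\<open>act A i\<close> is the identity on the summand of the identity of \<open>i\<close>.\<close>
  have alg_hom: "fun_of \<gamma> i \<cdot>\<^bsub>S\<^esub> farr U (\<epsilon> (fobj A i))
      = farr U (\<epsilon> (fobj B i)) \<cdot>\<^bsub>S\<^esub> farr U (farr F (fun_of \<gamma> i))" if i: "i \<in> Obj I" for i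
  proof -
    have "fun_of \<gamma> i \<cdot>\<^bsub>S\<^esub> farr U (\<epsilon> (fobj A i))
        = fun_of \<gamma> i \<cdot>\<^bsub>S\<^esub> (farr U (\<epsilon> (fobj A i)) \<cdot>\<^bsub>S\<^esub>
            farr U (farr F (act A i \<cdot>\<^bsub>S\<^esub> summand (fobj UI A) i (Id I i))))"
      using A i by (simp add: act_summand S.Comp_Id_right')
    also have "\<dots> = (fun_of \<gamma> i \<cdot>\<^bsub>S\<^esub> (farr U (\<epsilon> (fobj A i)) \<cdot>\<^bsub>S\<^esub> farr U (farr F (act A i))))
        \<cdot>\<^bsub>S\<^esub> farr U (farr F (summand (fobj UI A) i (Id I i)))"
      using A i by (simp add: V.farr_Comp L.farr_Comp S.Comp_right_assoc)
    also have "\<dots> = farr U (\<epsilon> (fobj B i)) \<cdot>\<^bsub>S\<^esub> farr U (farr F (act B i \<cdot>\<^bsub>S\<^esub>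
        (fun_of (farr (Lan \<U> I) \<gamma>) i \<cdot>\<^bsub>S\<^esub> summand (fobj UI A) i (Id I i))))"
      unfolding hom_at[OF i] using A B i \<gamma>
      by (simp add: V.farr_Comp L.farr_Comp S.Comp_right_assoc)
    also have "\<dots> = farr U (\<epsilon> (fobj B i)) \<cdot>\<^bsub>S\<^esub> farr U (farr F (fun_of \<gamma> i))"
      using A B i
      by (simp add: LanA act_summand S.Comp_front[OF act_summand] S.Comp_Id_left')
    finally show ?thesis .
  qed
  \<comment> \<open>By \<open>adjunct_unit\<close> both sides of the law restrict along \<open>\<eta>\<close> to maps out of the coproduct,
    which are then compared on the summand of \<open>x\<close>.\<close>
  have nat: "fun_of \<gamma> (Cod I x) \<cdot>\<^bsub>S\<^esub> farr U (farr A x)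
      = farr U (farr B x) \<cdot>\<^bsub>S\<^esub> fun_of \<gamma> (Dom I x)" if x: "x \<in> Arr I" for x
  proof -
    let ?i = "Cod I x"
    have "fun_of \<gamma> ?i \<cdot>\<^bsub>S\<^esub> farr U (farr A x)
        = (fun_of \<gamma> ?i \<cdot>\<^bsub>S\<^esub> (farr U (\<epsilon> (fobj A ?i)) \<cdot>\<^bsub>S\<^esub> farr U (farr F (act A ?i))))
          \<cdot>\<^bsub>S\<^esub> (\<eta> (Lan_set \<U> I (fobj UI A) ?i) \<cdot>\<^bsub>S\<^esub> summand (fobj UI A) ?i x)"
      using A x S.Comp_front[OF adjunct_unit[of "fobj A ?i" "act A ?i"], where f = "summand (fobj UI A) ?i x"]
      by (simp add: S.Comp_right_assoc act_summand)
    also have "\<dots> = (act B ?i \<cdot>\<^bsub>S\<^esub> fun_of (farr (Lan \<U> I) \<gamma>) ?i) \<cdot>\<^bsub>S\<^esub> summand (fobj UI A) ?i x"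
      unfolding hom_at[OF I.Cod_in[OF x]]
      using A B x \<gamma> S.Comp_front[OF adjunct_unit[of "fobj B ?i"
          "act B ?i \<cdot>\<^bsub>S\<^esub> fun_of (farr (Lan \<U> I) \<gamma>) ?i" "Lan_set \<U> I (fobj UI A) ?i"],
          where f = "summand (fobj UI A) ?i x"]
      by (simp add: S.Comp_right_assoc)
    also have "\<dots> = farr U (farr B x) \<cdot>\<^bsub>S\<^esub> fun_of \<gamma> (Dom I x)"
      using A B x \<gamma> by (simp add: S.Comp_right_assoc LanA S.Comp_front[OF act_summand])
    finally show ?thesis .
  qed
  have "\<exists>f. f \<in> Arr C \<and> Dom C f = fobj A i \<and> Cod C f = fobj B i \<and> farr U f = fun_of \<gamma> i"
    if i: "i \<in> Obj I" for i
    using A B i alg_hom[OF i] by (intro monadic_full[OF monadic]) simp_all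
  then obtain \<phi> where "\<And>i. i \<in> Obj I \<Longrightarrow>
      \<phi> i \<in> Arr C \<and> Dom C (\<phi> i) = fobj A i \<and> Cod C (\<phi> i) = fobj B i \<and> farr U (\<phi> i) = fun_of \<gamma> i"
    by metis
  then have \<phi> [simp]: "\<phi> i \<in> Arr C" "Dom C (\<phi> i) = fobj A i" "Cod C (\<phi> i) = fobj B i"
    "farr U (\<phi> i) = fun_of \<gamma> i" if "i \<in> Obj I" for i
    using that by auto
  define t where "t = \<lparr>src = A, tgt = B, fun_of = (\<lambda>i\<in>Obj I. \<phi> i)\<rparr>"
  have "\<phi> (Cod I f) \<cdot>\<^bsub>C\<^esub> farr A f = farr B f \<cdot>\<^bsub>C\<^esub> \<phi> (Dom I f)" if f: "f \<in> Arr I" for f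
    using A B f nat[OF f] by - (rule faithful, simp_all add: V.farr_Comp)
  then have t: "t \<in> Arr CI"
    using A B by (intro FunCat_ArrI) (simp_all add: t_def)
  moreover have "farr KI t = g"
  proof -
    have "farr UI t = \<gamma>"
    proof (rule FunCat_Arr_eqI[of _ "discrete I" S])
      show "farr UI t \<in> Arr Families"
        using t by (rule UI.farr_in)
    qed (use \<gamma> in \<open>simp_all add: t_def\<close>)
    then show ?thesis
      using g' by (intro arrow_eqI) (simp_all add: \<gamma>_def t_def)
  qed
  moreover have "s = t" if s: "s \<in> Hom CI A B" "farr KI s = g" for s
  proof -
    have s': "s \<in> Arr CI" "src s = A" "tgt s = B"
      using s by (simp_all add: Hom_def)
    have "farr UI s = \<gamma>"
      using s(2) by (auto simp: \<gamma>_def)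
    then have "farr U (fun_of s i) = fun_of \<gamma> i" if "i \<in> Obj I" for i
      using that by auto
    then show ?thesis
      using s' t FunCat_ArrD(4-6)[OF s'(1)]
      by (intro FunCat_Arr_eqI[OF s'(1) t]) (auto simp: t_def intro: faithful)
  qed
  ultimately show "\<exists>!t. t \<in> Hom CI A B \<and> farr KI t = g"
    by (intro ex1I[of _ t]) (auto simp: Hom_def t_def)
qed

end

section \<open>The comparison functor on diagrams is essentially surjective\<close>

locale diagram_algebra = diagram_adjunction +
  fixes X \<theta>
  assumes algebra: "(X, \<theta>) \<in> Obj AlgsI"
begin

lemma X_Obj [simp]: "X \<in> Obj Families"
  using Alg_ObjD(1)[OF algebra[unfolded adj_Alg_def]] by simp

definition "h i = fun_of \<theta> i"

abbreviation "LX i \<equiv> Lan_set \<U> I X i"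
abbreviation "T f \<equiv> farr U (farr F f)"

lemma h_in [simp]:
  assumes i: "i \<in> Obj I"
  shows "h i \<in> Arr S" "Dom S (h i) = fobj U (fobj F (LX i))" "Cod S (h i) = fobj X i"
proof -
  have "\<theta> \<in> Arr Families" "src \<theta> = fobj UI (fobj FI X)" "tgt \<theta> = X"
    using Alg_ObjD(2-4)[OF algebra[unfolded adj_Alg_def]] by simp_all
  then show "h i \<in> Arr S" "Dom S (h i) = fobj U (fobj F (LX i))" "Cod S (h i) = fobj X i"
    using Families_ArrD(4-6)[of \<theta> i] i by (simp_all add: h_def)
qed

lemma \<theta>_Arr: "\<theta> \<in> Arr Families" "src \<theta> = fobj UI (fobj FI X)" "tgt \<theta> = X"
  using Alg_ObjD(2-4)[OF algebra[unfolded adj_Alg_def]] by simp_all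

lemma h_unit:
  assumes i: "i \<in> Obj I"
  shows "h i \<cdot>\<^bsub>S\<^esub> (\<eta> (LX i) \<cdot>\<^bsub>S\<^esub> summand X i (Id I i)) = Id S (fobj X i)"
proof -
  have "\<theta> \<cdot>\<^bsub>Families\<^esub> \<eta>I X = Id Families X"
    using Alg_ObjD(5)[OF algebra[unfolded adj_Alg_def]] by simp
  from arg_cong[OF this, of "\<lambda>t. fun_of t i"] show ?thesis
    using i by (simp add: h_def)
qed

text \<open>At \<open>i\<close> the multiplication of the monad on diagrams is \<open>T\<close> of the action of \<open>I\<close> on
  \<open>T (Lan X)\<close>, followed by \<open>U \<epsilon>\<close>; this is the associative law with both written out.\<close>

lemma h_assoc:
  assumes i: "i \<in> Obj I"
  shows "h i \<cdot>\<^bsub>S\<^esub> T (fun_of (farr (Lan \<U> I) \<theta>) i)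
    = h i \<cdot>\<^bsub>S\<^esub> (farr U (\<epsilon> (fobj F (LX i))) \<cdot>\<^bsub>S\<^esub> T (act (fobj FI X) i))"
proof -
  have "\<theta> \<cdot>\<^bsub>Families\<^esub> farr UI (farr FI \<theta>) = \<theta> \<cdot>\<^bsub>Families\<^esub> farr UI (\<epsilon>I (fobj FI X))"
    using Alg_ObjD(6)[OF algebra[unfolded adj_Alg_def]] by simp
  from arg_cong[OF this, of "\<lambda>t. fun_of t i"] show ?thesis
    using i by (simp add: h_def V.farr_Comp)
qed

lemma Lan_\<theta>_summand:
  assumes "x \<in> Arr I" "Cod I x = i"
  shows "fun_of (farr (Lan \<U> I) \<theta>) i \<cdot>\<^bsub>S\<^esub> summand (fobj UI (fobj FI X)) i x
    = summand X i x \<cdot>\<^bsub>S\<^esub> h (Dom I x)"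
  using farr_Lan_summand[OF \<theta>_Arr(1) assms] \<theta>_Arr by (simp add: h_def)

lemma Lan_\<theta>_in [simp]:
  assumes "i \<in> Obj I"
  shows "fun_of (farr (Lan \<U> I) \<theta>) i \<in> Arr S"
    "Dom S (fun_of (farr (Lan \<U> I) \<theta>) i) = Lan_set \<U> I (fobj UI (fobj FI X)) i"
    "Cod S (fun_of (farr (Lan \<U> I) \<theta>) i) = LX i"
  using assms \<theta>_Arr by simp_all

lemma T_simps [simp]:
  assumes "f \<in> Arr S"
  shows "T f \<in> Arr S" "Dom S (T f) = fobj U (fobj F (Dom S f))"
    "Cod S (T f) = fobj U (fobj F (Cod S f))"
  using assms by simp_all

lemma T_Comp:
  "f \<in> Arr S \<Longrightarrow> g \<in> Arr S \<Longrightarrow> Cod S f = Dom S g \<Longrightarrow> T (g \<cdot>\<^bsub>S\<^esub> f) = T g \<cdot>\<^bsub>S\<^esub> T f"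
  by (simp add: L.farr_Comp V.farr_Comp)

text \<open>The pieces of the diagram of \<open>T\<close>-algebras: the structure maps \<open>alg i\<close>, the transition maps
  \<open>tr f\<close>, and all transition maps into \<open>i\<close> gathered into \<open>act_X i\<close>, in analogy with \<open>act\<close>.\<close>

definition "alg i = h i \<cdot>\<^bsub>S\<^esub> T (summand X i (Id I i))"

definition "act_X i = h i \<cdot>\<^bsub>S\<^esub> \<eta> (LX i)"

definition "tr f = act_X (Cod I f) \<cdot>\<^bsub>S\<^esub> summand X (Cod I f) f"

lemma alg_in [simp]:
  assumes "i \<in> Obj I"
  shows "alg i \<in> Arr S" "Dom S (alg i) = fobj U (fobj F (fobj X i))" "Cod S (alg i) = fobj X i"
  using assms by (simp_all add: alg_def)

lemma act_X_in [simp]: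
  assumes "i \<in> Obj I"
  shows "act_X i \<in> Arr S" "Dom S (act_X i) = LX i" "Cod S (act_X i) = fobj X i"
  using assms by (simp_all add: act_X_def)

lemma tr_in [simp]:
  assumes "f \<in> Arr I"
  shows "tr f \<in> Arr S" "Dom S (tr f) = fobj X (Dom I f)" "Cod S (tr f) = fobj X (Cod I f)"
  using assms by (simp_all add: tr_def)

text \<open>The associative law restricted along \<open>T\<close> of the summand of the identity, on which \<open>act\<close> is the
  identity.\<close>

lemma alg_T_h:
  assumes i: "i \<in> Obj I"
  shows "alg i \<cdot>\<^bsub>S\<^esub> T (h i) = h i \<cdot>\<^bsub>S\<^esub> farr U (\<epsilon> (fobj F (LX i)))"
proof -
  let ?s = "summand (fobj UI (fobj FI X)) i (Id I i)"
  have "alg i \<cdot>\<^bsub>S\<^esub> T (h i) = h i \<cdot>\<^bsub>S\<^esub> T (fun_of (farr (Lan \<U> I) \<theta>) i \<cdot>\<^bsub>S\<^esub> ?s)"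
    using i by (simp add: alg_def Lan_\<theta>_summand T_Comp S.Comp_right_assoc)
  also have "\<dots> = (h i \<cdot>\<^bsub>S\<^esub> T (fun_of (farr (Lan \<U> I) \<theta>) i)) \<cdot>\<^bsub>S\<^esub> T ?s"
    using i by (simp add: T_Comp S.Comp_right_assoc)
  also have "\<dots> = h i \<cdot>\<^bsub>S\<^esub> (farr U (\<epsilon> (fobj F (LX i))) \<cdot>\<^bsub>S\<^esub> T (act (fobj FI X) i \<cdot>\<^bsub>S\<^esub> ?s))"
    unfolding h_assoc[OF i] using i by (simp add: T_Comp S.Comp_right_assoc)
  also have "\<dots> = h i \<cdot>\<^bsub>S\<^esub> farr U (\<epsilon> (fobj F (LX i)))"
    using i FunCat_Obj_at(5)[OF Lan_obj_Obj[OF X_Obj] i]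
    by (simp add: act_summand S.Comp_Id_right')
  finally show ?thesis .
qed

text \<open>The associative law restricted along \<open>\<eta>\<close> and the summand of \<open>f\<close>, on which \<open>act\<close> is
  \<open>T (Lan X f)\<close>.\<close>

lemma tr_h:
  assumes f: "f \<in> Arr I"
  shows "tr f \<cdot>\<^bsub>S\<^esub> h (Dom I f) = h (Cod I f) \<cdot>\<^bsub>S\<^esub> T (farr (Lan_obj \<U> I X) f)"
proof -
  let ?i = "Cod I f" and ?Y = "fobj UI (fobj FI X)"
  let ?s = "summand ?Y ?i f" and ?L = "fun_of (farr (Lan \<U> I) \<theta>) ?i"
  have nat: "T ?L \<cdot>\<^bsub>S\<^esub> \<eta> (Lan_set \<U> I ?Y ?i) = \<eta> (LX ?i) \<cdot>\<^bsub>S\<^esub> ?L"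
    using f unit_natural[of ?L] by simp
  have "tr f \<cdot>\<^bsub>S\<^esub> h (Dom I f) = h ?i \<cdot>\<^bsub>S\<^esub> (\<eta> (LX ?i) \<cdot>\<^bsub>S\<^esub> (?L \<cdot>\<^bsub>S\<^esub> ?s))"
    using f by (simp add: tr_def act_X_def Lan_\<theta>_summand S.Comp_right_assoc)
  also have "\<dots> = (h ?i \<cdot>\<^bsub>S\<^esub> T ?L) \<cdot>\<^bsub>S\<^esub> (\<eta> (Lan_set \<U> I ?Y ?i) \<cdot>\<^bsub>S\<^esub> ?s)"
    using f by (simp add: S.Comp_right_assoc S.Comp_front[OF nat])
  also have "\<dots> = h ?i \<cdot>\<^bsub>S\<^esub> (act (fobj FI X) ?i \<cdot>\<^bsub>S\<^esub> ?s)"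
    unfolding h_assoc[OF I.Cod_in[OF f]]
    using f S.Comp_front[OF adjunct_unit[of "fobj F (LX ?i)" "act (fobj FI X) ?i"], where f = ?s]
    by (simp add: S.Comp_right_assoc)
  also have "\<dots> = h ?i \<cdot>\<^bsub>S\<^esub> T (farr (Lan_obj \<U> I X) f)"
    using f by (simp add: act_summand)
  finally show ?thesis .
qed

text \<open>Restrict \<open>alg_T_h\<close> along \<open>T \<eta>\<close>; the right side collapses by a triangle identity.\<close>

lemma h_eq_alg_act_X:
  assumes i: "i \<in> Obj I"
  shows "h i = alg i \<cdot>\<^bsub>S\<^esub> T (act_X i)"
proof -
  have "alg i \<cdot>\<^bsub>S\<^esub> T (act_X i) = (alg i \<cdot>\<^bsub>S\<^esub> T (h i)) \<cdot>\<^bsub>S\<^esub> T (\<eta> (LX i))"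
    using i by (simp add: act_X_def T_Comp S.Comp_right_assoc)
  also have "\<dots> = h i \<cdot>\<^bsub>S\<^esub> farr U (\<epsilon> (fobj F (LX i)) \<cdot>\<^bsub>C\<^esub> farr F (\<eta> (LX i)))"
    unfolding alg_T_h[OF i] using i by (simp add: V.farr_Comp S.Comp_right_assoc)
  also have "\<dots> = h i"
    using i by (simp add: triangle_left S.Comp_Id_right')
  finally show ?thesis ..
qed

lemma alg_unit:
  assumes i: "i \<in> Obj I"
  shows "alg i \<cdot>\<^bsub>S\<^esub> \<eta> (fobj X i) = Id S (fobj X i)"
  using i h_unit[OF i] unit_natural[of "summand X i (Id I i)"]
  by (simp add: alg_def S.Comp_right_assoc)

text \<open>Restrict \<open>alg_T_h\<close> along \<open>T T\<close> of the summand of the identity and use naturality of \<open>\<epsilon>\<close>.\<close>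

lemma alg_assoc:
  assumes i: "i \<in> Obj I"
  shows "alg i \<cdot>\<^bsub>S\<^esub> T (alg i) = alg i \<cdot>\<^bsub>S\<^esub> farr U (\<epsilon> (fobj F (fobj X i)))"
proof -
  let ?s = "summand X i (Id I i)"
  have nat: "\<epsilon> (fobj F (LX i)) \<cdot>\<^bsub>C\<^esub> farr F (T ?s) = farr F ?s \<cdot>\<^bsub>C\<^esub> \<epsilon> (fobj F (fobj X i))"
    using i counit_natural[of "farr F ?s"] by simp
  have "alg i \<cdot>\<^bsub>S\<^esub> T (alg i) = (alg i \<cdot>\<^bsub>S\<^esub> T (h i)) \<cdot>\<^bsub>S\<^esub> T (T ?s)"
    using i by (simp add: alg_def[of i] T_Comp S.Comp_right_assoc)
  also have "\<dots> = h i \<cdot>\<^bsub>S\<^esub> farr U (\<epsilon> (fobj F (LX i)) \<cdot>\<^bsub>C\<^esub> farr F (T ?s))"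
    unfolding alg_T_h[OF i] using i by (simp add: V.farr_Comp S.Comp_right_assoc)
  also have "\<dots> = alg i \<cdot>\<^bsub>S\<^esub> farr U (\<epsilon> (fobj F (fobj X i)))"
    unfolding nat using i by (simp add: alg_def V.farr_Comp S.Comp_right_assoc)
  finally show ?thesis .
qed

text \<open>Restrict \<open>tr_h\<close> along \<open>T\<close> of the summand of the identity, which \<open>Lan X f\<close> takes to the summand
  of \<open>f\<close>, and expand \<open>h\<close> by \<open>h_eq_alg_act_X\<close>.\<close>

lemma tr_alg:
  assumes f: "f \<in> Arr I"
  shows "tr f \<cdot>\<^bsub>S\<^esub> alg (Dom I f) = alg (Cod I f) \<cdot>\<^bsub>S\<^esub> T (tr f)"
proof -
  have "tr f \<cdot>\<^bsub>S\<^esub> alg (Dom I f) = (tr f \<cdot>\<^bsub>S\<^esub> h (Dom I f)) \<cdot>\<^bsub>S\<^esub> T (summand X (Dom I f) (Id I (Dom I f)))"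
    using f by (simp add: alg_def S.Comp_right_assoc)
  also have "\<dots> = h (Cod I f) \<cdot>\<^bsub>S\<^esub>
      T (farr (Lan_obj \<U> I X) f \<cdot>\<^bsub>S\<^esub> summand X (Dom I f) (Id I (Dom I f)))"
    unfolding tr_h[OF f] using f by (simp add: T_Comp S.Comp_right_assoc)
  also have "\<dots> = (alg (Cod I f) \<cdot>\<^bsub>S\<^esub> T (act_X (Cod I f))) \<cdot>\<^bsub>S\<^esub> T (summand X (Cod I f) f)"
    using f by (simp add: farr_Lan_obj_summand h_eq_alg_act_X[symmetric])
  also have "\<dots> = alg (Cod I f) \<cdot>\<^bsub>S\<^esub> T (tr f)"
    using f by (simp add: tr_def T_Comp S.Comp_right_assoc)
  finally show ?thesis .
qed

lemma tr_Id:
  assumes i: "i \<in> Obj I"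
  shows "tr (Id I i) = Id S (fobj X i)"
  using i h_unit[OF i] by (simp add: tr_def act_X_def S.Comp_right_assoc)

text \<open>Restrict \<open>tr_h\<close> for \<open>g\<close> along \<open>\<eta>\<close> and the summand of \<open>f\<close>, which \<open>Lan X g\<close> takes to the summand
  of \<open>g \<cdot> f\<close>.\<close>

lemma tr_Comp:
  assumes fg: "f \<in> Arr I" "g \<in> Arr I" "Cod I f = Dom I g"
  shows "tr (g \<cdot>\<^bsub>I\<^esub> f) = tr g \<cdot>\<^bsub>S\<^esub> tr f"
proof -
  let ?Lg = "farr (Lan_obj \<U> I X) g"
  have nat: "T ?Lg \<cdot>\<^bsub>S\<^esub> \<eta> (LX (Dom I g)) = \<eta> (LX (Cod I g)) \<cdot>\<^bsub>S\<^esub> ?Lg"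
    using fg unit_natural[of ?Lg] by simp
  have "tr g \<cdot>\<^bsub>S\<^esub> tr f
      = (tr g \<cdot>\<^bsub>S\<^esub> h (Dom I g)) \<cdot>\<^bsub>S\<^esub> (\<eta> (LX (Dom I g)) \<cdot>\<^bsub>S\<^esub> summand X (Dom I g) f)"
    using fg by (simp add: tr_def[of f] act_X_def S.Comp_right_assoc)
  also have "\<dots> = h (Cod I g) \<cdot>\<^bsub>S\<^esub> (\<eta> (LX (Cod I g)) \<cdot>\<^bsub>S\<^esub> (?Lg \<cdot>\<^bsub>S\<^esub> summand X (Dom I g) f))"
    unfolding tr_h[OF fg(2)] using fg by (simp add: S.Comp_right_assoc S.Comp_front[OF nat])
  also have "\<dots> = tr (g \<cdot>\<^bsub>I\<^esub> f)"
    using fg by (simp add: farr_Lan_obj_summand tr_def act_X_def S.Comp_right_assoc)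
  finally show ?thesis ..
qed

definition "P = \<lparr>fobj = (\<lambda>i\<in>Obj I. (fobj X i, alg i)),
  farr = (\<lambda>f\<in>Arr I. \<lparr>src = (fobj X (Dom I f), alg (Dom I f)),
    tgt = (fobj X (Cod I f), alg (Cod I f)), fun_of = tr f\<rparr>)\<rparr>"

lemma P_simps [simp]:
  "i \<in> Obj I \<Longrightarrow> fobj P i = (fobj X i, alg i)"
  "f \<in> Arr I \<Longrightarrow> farr P f = \<lparr>src = (fobj X (Dom I f), alg (Dom I f)),
    tgt = (fobj X (Cod I f), alg (Cod I f)), fun_of = tr f\<rparr>"
  by (simp_all add: P_def)

lemma P_Obj: "P \<in> Obj (FunCat I Algs)"
proof (rule FunCat_ObjI)
  have obj: "(fobj X i, alg i) \<in> Obj Algs" if "i \<in> Obj I" for i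
    unfolding adj_Alg_def using that by (intro Alg_ObjI) (simp_all add: alg_unit alg_assoc)
  have "farr P f \<in> Arr Algs" if "f \<in> Arr I" for f
    unfolding adj_Alg_def using that obj[of "Dom I f"] obj[of "Cod I f"]
    by (intro Alg_ArrI) (simp_all add: adj_Alg_def tr_alg)
  then show "is_functor I Algs P"
    using obj adj_Alg_category I.category_axioms
    by (intro is_functorI) (simp_all add: adj_Alg_def tr_Id tr_Comp)
qed (simp_all add: P_def)

text \<open>The isomorphisms \<open>s i : U (A i) \<rightarrow> X i\<close> of \<open>T\<close>-algebras coming from the equivalence
  are natural in \<open>i\<close>, hence compatible with \<open>act A\<close> and \<open>act_X\<close>. As \<open>h\<close> is composed of \<open>alg\<close> and
  \<open>act_X\<close>, they form a homomorphism to \<open>(X, \<theta>)\<close>.\<close>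

lemma comparison_I_hits_algebra:
  assumes monadic: "monadic S C F U \<eta> \<epsilon>"
  shows "\<exists>A \<in> Obj CI. \<exists>p. is_iso AlgsI p \<and> Dom AlgsI p = fobj KI A \<and> Cod AlgsI p = (X, \<theta>)"
proof -
  obtain G where "is_functor Algs C G" and "naturally_isomorphic Algs Algs (comp_ftor K G) id_ftor"
    using monadic by (auto simp: monadic_def is_equivalence_def)
  then obtain \<sigma> where "nat_trans Algs Algs (comp_ftor K G) id_ftor \<sigma>"
    and \<sigma>_iso: "\<And>a. a \<in> Obj Algs \<Longrightarrow> is_iso Algs (\<sigma> a)"
    by (auto simp: naturally_isomorphic_def)
  then interpret \<sigma>: nat_trans Algs Algs "comp_ftor K G" id_ftor \<sigma>
    by simp
  interpret G: is_functor Algs C G by fact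
  define A where "A = fobj (postcomp I G) P"
  have A: "A \<in> Obj CI"
    unfolding A_def
    by (rule is_functor.fobj_in[OF postcomp_functor[OF I.category_axioms I.category_axioms
      G.is_functor_axioms] P_Obj]) simp_all
  have A_at: "fobj A i = fobj G (fobj P i)" if "i \<in> Obj I" for i
    using that by (simp add: A_def)
  have A_arr: "farr A f = farr G (farr P f)" if "f \<in> Arr I" for f
    using that by (simp add: A_def)
  note P = FunCat_Obj_at[OF P_Obj]
  define s where "s i = fun_of (\<sigma> (fobj P i))" for i
  have \<sigma>P: "\<sigma> (fobj P i) \<in> Arr (Alg S (comp_ftor U F) \<eta> (\<lambda>x. farr U (\<epsilon> (fobj F x))))"
    "src (\<sigma> (fobj P i)) = (fobj U (fobj A i), farr U (\<epsilon> (fobj A i)))"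
    "tgt (\<sigma> (fobj P i)) = (fobj X i, alg i)" if i: "i \<in> Obj I" for i
    using \<sigma>.component_in[OF P(1)[OF i]] \<sigma>.Dom_component[OF P(1)[OF i]]
      \<sigma>.Cod_component[OF P(1)[OF i]] i
    by (simp_all add: adj_Alg_def A_at)
  have s [simp]: "s i \<in> Arr S" "Dom S (s i) = fobj U (fobj A i)" "Cod S (s i) = fobj X i"
    and s_hom: "s i \<cdot>\<^bsub>S\<^esub> farr U (\<epsilon> (fobj A i)) = alg i \<cdot>\<^bsub>S\<^esub> T (s i)" if i: "i \<in> Obj I" for i
    using Alg_ArrD(3-6)[OF \<sigma>P(1)[OF i]] \<sigma>P(2-)[OF i] by (simp_all add: s_def)
  have s_nat: "s (Cod I f) \<cdot>\<^bsub>S\<^esub> farr U (farr A f) = tr f \<cdot>\<^bsub>S\<^esub> s (Dom I f)" if f: "f \<in> Arr I" for f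
    using arg_cong[OF \<sigma>.naturality[OF P(2)[OF f]], of fun_of] f
    by (simp add: P(3,4) A_arr s_def adj_Alg_def)
  have s_iso: "is_iso S (s i)" if i: "i \<in> Obj I" for i
  proof -
    obtain k where k: "k \<in> Arr Algs" "Dom Algs k = Cod Algs (\<sigma> (fobj P i))"
      "Cod Algs k = Dom Algs (\<sigma> (fobj P i))"
      "k \<cdot>\<^bsub>Algs\<^esub> \<sigma> (fobj P i) = Id Algs (Dom Algs (\<sigma> (fobj P i)))"
      "\<sigma> (fobj P i) \<cdot>\<^bsub>Algs\<^esub> k = Id Algs (Cod Algs (\<sigma> (fobj P i)))"
      using category.is_isoE[OF adj_Alg_category \<sigma>_iso[OF P(1)[OF i]]] by metis
    show ?thesis
      using Alg_ArrD(3-5)[OF k(1)[unfolded adj_Alg_def]] k(2,3)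
        arg_cong[OF k(4), of fun_of] arg_cong[OF k(5), of fun_of] \<sigma>P(2,3)[OF i] i
        s[OF i, unfolded s_def]
      by (intro S.is_isoI[of _ "fun_of k"]) (simp_all add: adj_Alg_def s_def)
  qed
  define t where "t = \<lparr>src = fobj UI A, tgt = X, fun_of = (\<lambda>i\<in>Obj I. s i)\<rparr>"
  have t: "t \<in> Arr Families"
    using A by (intro FunCat_discrete_ArrI I.category_axioms S.category_axioms)
      (simp_all add: t_def)
  have t_simps [simp]: "src t = fobj UI A" "tgt t = X" "i \<in> Obj I \<Longrightarrow> fun_of t i = s i" for i
    by (simp_all add: t_def)
  have Lt [simp]: "fun_of (farr (Lan \<U> I) t) i \<in> Arr S"
    "Dom S (fun_of (farr (Lan \<U> I) t) i) = Lan_set \<U> I (fobj UI A) i"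
    "Cod S (fun_of (farr (Lan \<U> I) t) i) = LX i" if "i \<in> Obj I" for i
    using that t by simp_all
  have act_X_s: "act_X i \<cdot>\<^bsub>S\<^esub> fun_of (farr (Lan \<U> I) t) i = s i \<cdot>\<^bsub>S\<^esub> act A i" if i: "i \<in> Obj I" for i
  proof (rule summands_jointly_epic[of "fobj UI A" _ i])
    fix x assume x: "x \<in> Arr I" "Cod I x = i"
    show "(act_X i \<cdot>\<^bsub>S\<^esub> fun_of (farr (Lan \<U> I) t) i) \<cdot>\<^bsub>S\<^esub> summand (fobj UI A) i x
        = (s i \<cdot>\<^bsub>S\<^esub> act A i) \<cdot>\<^bsub>S\<^esub> summand (fobj UI A) i x"
      using A x i farr_Lan_summand[OF t x] s_nat[OF x(1)]
      by (simp add: S.Comp_right_assoc act_summand tr_def)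
  qed (use A i in simp_all)
  have hom: "s i \<cdot>\<^bsub>S\<^esub> farr U (\<epsilon> (fobj A i) \<cdot>\<^bsub>C\<^esub> farr F (act A i))
      = h i \<cdot>\<^bsub>S\<^esub> T (fun_of (farr (Lan \<U> I) t) i)" if i: "i \<in> Obj I" for i
  proof -
    have "s i \<cdot>\<^bsub>S\<^esub> farr U (\<epsilon> (fobj A i) \<cdot>\<^bsub>C\<^esub> farr F (act A i))
        = (alg i \<cdot>\<^bsub>S\<^esub> T (s i)) \<cdot>\<^bsub>S\<^esub> T (act A i)"
      unfolding s_hom[OF i, symmetric] using A i by (simp add: V.farr_Comp S.Comp_right_assoc)
    also have "\<dots> = alg i \<cdot>\<^bsub>S\<^esub> T (act_X i \<cdot>\<^bsub>S\<^esub> fun_of (farr (Lan \<U> I) t) i)"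
      using A i by (simp add: act_X_s T_Comp S.Comp_right_assoc)
    also have "\<dots> = h i \<cdot>\<^bsub>S\<^esub> T (fun_of (farr (Lan \<U> I) t) i)"
      unfolding h_eq_alg_act_X[OF i] using A i by (simp add: T_Comp S.Comp_right_assoc)
    finally show ?thesis .
  qed
  define p where "p = \<lparr>src = fobj KI A, tgt = (X, \<theta>), fun_of = t\<rparr>"
  have "p \<in> Arr AlgsI"
    using adjI.comparison_functor[THEN is_functor.fobj_in, OF A] algebra t hom
    unfolding adj_Alg_def
    by (intro Alg_ArrI)
      (auto simp: p_def h_def \<theta>_Arr intro!: arrow_eqI restrict_ext)
  then have "is_iso AlgsI p"
    unfolding adj_Alg_def
    by (rule Alg_is_iso[OF adjI.monad_functor])
      (use t s_iso in \<open>auto simp: p_def intro: Families_is_isoI\<close>)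
  then show ?thesis
    using A by (intro bexI[of _ A] exI[of _ p]) (simp_all add: p_def adj_Alg_def)
qed

end

section \<open>Monadicity\<close>

lemma (in diagram_adjunction) monadic_I:
  assumes monadic: "monadic S C F U \<eta> \<epsilon>"
  shows "monadic Families CI FI UI \<eta>I \<epsilon>I"
  unfolding monadic_def
proof (rule equivalence_if_fully_faithful)
  show "is_functor CI AlgsI KI"
    by (rule adjI.comparison_functor)
  show "fully_faithful CI AlgsI KI"
    by (rule comparison_I_fully_faithful) fact
  show "essentially_surjective CI AlgsI KI"
    unfolding essentially_surjective_def
  proof
    fix a assume "a \<in> Obj AlgsI"
    then interpret diagram_algebra \<U> I C F U \<eta> \<epsilon> "fst a" "snd a"
      by unfold_locales simp
    show "\<exists>A\<in>Obj CI. \<exists>p. is_iso AlgsI p \<and> Dom AlgsI p = fobj KI A \<and> Cod AlgsI p = a"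
      using comparison_I_hits_algebra[OF monadic] by simp
  qed
qed

theorem lemma3p2:
  fixes \<U> :: "'u set set"
    and C :: "('o, 'm) cat"
    and I :: "('i, 'n) cat"
    and F :: "('u set, 'u setarr, 'o, 'm) ftor"
    and U :: "('o, 'm, 'u set, 'u setarr) ftor"
    and \<eta> :: "'u set \<Rightarrow> 'u setarr"
    and \<epsilon> :: "'o \<Rightarrow> 'm"
  assumes "set_universe \<U>"
    and "category C"
    and "small_category \<U> I"
    and "adjunction (Sets \<U>) C F U \<eta> \<epsilon>"
    and "monadic (Sets \<U>) C F U \<eta> \<epsilon>"
  shows "adjunction (FunCat (discrete I) (Sets \<U>)) (FunCat I C) (F_I \<U> I F) (U_I I U)
           (unit_I \<U> I F U \<eta>) (counit_I \<U> I C F U \<epsilon>)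
       \<and> monadic (FunCat (discrete I) (Sets \<U>)) (FunCat I C) (F_I \<U> I F) (U_I I U)
           (unit_I \<U> I F U \<eta>) (counit_I \<U> I C F U \<epsilon>)"
proof -
  interpret set_universe \<U> by fact
  interpret I: category I
    using assms(3) by (simp add: small_category_def)
  interpret adjunction "Sets \<U>" C F U \<eta> \<epsilon> by fact
  interpret diagram_adjunction \<U> I C F U \<eta> \<epsilon>
    by unfold_locales fact
  show ?thesis
    using adjunction_I monadic_I[OF assms(5)] by blast
qed

end
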